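(* Let $w$ be a group-word. Then $w$ is concise in the class of residually finite groups if and only if $w$ is concise in the class of groups that are virtually pro-$p$ (for some prime $p$, which may depend on the group).
   Context: For a group $G$ and a group-word $w=w(x_1,\dots,x_k)$, the $w$-values in $G$ are the elements $w(g_1,\dots,g_k)$ with $g_i\in G$, and the verbal subgroup $w(G)$ is the (abstract) subgroup generated by all $w$-values. A word $w$ is concise in a class of groups $\mathcal X$ if $w(G)$ is finite whenever $G\in\mathcal X$ and the set of $w$-values in $G$ is finite. A virtually pro-$p$ group is a profinite group having an open subgroup (i.e. a closed subgroup of finite index) that is a pro-$p$ group. *)

theory Defs
  imports "HOL-Analysis.T1_Spaces" "HOL-Algebra.Generated_Groups"
    "HOL-Library.Equipollence" "HOL-Computational_Algebra.Primes" Complex_Main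
begin

text \<open>
  A group word is a finite product of letters: \<open>(i, True)\<close> stands for \<open>x\<^sub>i\<close> and \<open>(i, False)\<close> for
  its inverse. Words need not be reduced, since cancelling does not change the values. The
  variables of a word are implicit: an assignment \<open>g\<close> gives a value to every \<open>x\<^sub>i\<close>, but only the
  finitely many variables that occur in the word matter.
\<close>

type_synonym group_word = "(nat \<times> bool) list"

fun word_eval :: "('a, 'm) monoid_scheme \<Rightarrow> (nat \<Rightarrow> 'a) \<Rightarrow> group_word \<Rightarrow> 'a" where
  "word_eval G g [] = \<one>\<^bsub>G\<^esub>"
| "word_eval G g ((i, e) # w) = (if e then g i else inv\<^bsub>G\<^esub> (g i)) \<otimes>\<^bsub>G\<^esub> word_eval G g w"

definition word_values :: "('a, 'm) monoid_scheme \<Rightarrow> group_word \<Rightarrow> 'a set" where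
  "word_values G w = {word_eval G g w | g. \<forall>i. g i \<in> carrier G}"

definition verbal_subgroup :: "('a, 'm) monoid_scheme \<Rightarrow> group_word \<Rightarrow> 'a set" where
  "verbal_subgroup G w = generate G (word_values G w)"

definition concise_in :: "group_word \<Rightarrow> 'a monoid set \<Rightarrow> bool" where
  "concise_in w \<X> \<longleftrightarrow> (\<forall>G\<in>\<X>. finite (word_values G w) \<longrightarrow> finite (verbal_subgroup G w))"

definition residually_finite :: "('a, 'm) monoid_scheme \<Rightarrow> bool" where
  "residually_finite G \<longleftrightarrow> group G \<and>
     (\<forall>x\<in>carrier G. x \<noteq> \<one>\<^bsub>G\<^esub> \<longrightarrow> (\<exists>N. N \<lhd> G \<and> finite (rcosets\<^bsub>G\<^esub> N) \<and> x \<notin> N))"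

definition topological_group :: "('a, 'm) monoid_scheme \<Rightarrow> 'a topology \<Rightarrow> bool" where
  "topological_group G T \<longleftrightarrow> group G \<and> topspace T = carrier G \<and>
     continuous_map (prod_topology T T) T (\<lambda>(x, y). x \<otimes>\<^bsub>G\<^esub> y) \<and>
     continuous_map T T (\<lambda>x. inv\<^bsub>G\<^esub> x)"

definition totally_disconnected_space :: "'a topology \<Rightarrow> bool" where
  "totally_disconnected_space T \<longleftrightarrow> (\<forall>S. connectedin T S \<longrightarrow> (\<exists>a. S \<subseteq> {a}))"

definition profinite_group :: "('a, 'm) monoid_scheme \<Rightarrow> 'a topology \<Rightarrow> bool" where
  "profinite_group G T \<longleftrightarrow> topological_group G T \<and>
     compact_space T \<and> Hausdorff_space T \<and> totally_disconnected_space T"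

text \<open>
  Open subgroups of a compact group have finite index, so \<^const>\<open>card\<close> below is never the default
  value for infinite sets (which would not be a power of \<open>p\<close> anyway).
\<close>

definition pro_p_group :: "nat \<Rightarrow> ('a, 'm) monoid_scheme \<Rightarrow> 'a topology \<Rightarrow> bool" where
  "pro_p_group p G T \<longleftrightarrow> prime p \<and> profinite_group G T \<and>
     (\<forall>N. N \<lhd> G \<and> openin T N \<longrightarrow> (\<exists>n. card (rcosets\<^bsub>G\<^esub> N) = p ^ n))"

definition virtually_pro_p_group :: "nat \<Rightarrow> ('a, 'm) monoid_scheme \<Rightarrow> 'a topology \<Rightarrow> bool" where
  "virtually_pro_p_group p G T \<longleftrightarrow> profinite_group G T \<and>
     (\<exists>H. subgroup H G \<and> openin T H \<and> pro_p_group p (G\<lparr>carrier := H\<rparr>) (subtopology T H))"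

text \<open>
  A class of groups is represented by its members with elements in a type \<open>'a\<close>. This loses nothing
  as long as \<open>'a\<close> is large enough. If \<open>w\<close> has finitely many values in \<open>G\<close> but generates an infinite
  verbal subgroup, the same holds in the subgroup generated (topologically, if \<open>G\<close> is profinite)
  by finitely many elements that produce all the values. So a failure of conciseness in the class
  of residually finite groups already shows in a countable group, and one in the class of virtually
  pro-\<open>p\<close> groups in a group of cardinality at most that of the continuum.
\<close>

definition residually_finite_groups :: "'a monoid set" where
  "residually_finite_groups = {G. residually_finite G}"

definition virtually_pro_p_groups :: "'a monoid set" where
  "virtually_pro_p_groups = {G. \<exists>p T. prime p \<and> virtually_pro_p_group p G T}"

end

theory Submission
  imports Defs "HOL-Algebra.Sylow" "HOL-Algebra.Group_Action" "HOL-Algebra.Weak_Morphisms"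
    "HOL-Algebra.Product_Groups" "HOL-Algebra.Multiplicative_Group"
    "HOL-Analysis.Abstract_Topological_Spaces"
begin

text \<open>
  If \<open>G\<close> is residually finite with finitely many \<open>w\<close>-values, a normal subgroup \<open>N\<^sub>0\<close> of finite
  index that separates them has the property that \<open>w\<close>-values depend only on the cosets of \<open>N\<^sub>0\<close> of
  the arguments. So for \<open>N \<subseteq> N\<^sub>0\<close> normal of finite index, \<open>Q = G/N\<close> covers \<open>F = G/N\<^sub>0\<close> and
  \<open>w\<close>-values in \<open>Q\<close> depend only on images in \<open>F\<close>; we must bound \<open>|w(Q)|\<close> for such covers in terms
  of \<open>F\<close>. Passing to a subgroup of \<open>Q\<close> changes neither the values nor the hypothesis as long as it still
  maps onto \<open>F\<close>. If it is minimal with this property, then the Sylow subgroups of the kernel \<open>M\<close> are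
  normal in \<open>Q\<close> by the Frattini argument, and their primes divide \<open>|F|\<close> because a coprime one could
  be split off modulo its derived subgroup. Embedding \<open>w(Q)\<close> into the product of its images modulo
  two Sylow subgroups reduces the bound to the case that \<open>M\<close> is a \<open>p\<close>-group. If there were such covers
  \<open>Q\<^sub>i\<close> with \<open>|w(Q\<^sub>i)|\<close> unbounded, their fibre product over \<open>F\<close> would be virtually pro-\<open>p\<close> with
  only finitely many \<open>w\<close>-values, yet its verbal subgroup would map onto every \<open>w(Q\<^sub>i)\<close>.

  Conversely, profinite groups are residually finite, and so is the countable subgroup
  generated by finitely many elements that produce all the values.
\<close>

section \<open>Word values and verbal subgroups\<close>


lemma word_eval_closed:
  assumes "group G" "\<And>i. g i \<in> carrier G"
  shows "word_eval G g w \<in> carrier G"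
proof -
  interpret group G by fact
  show ?thesis using assms(2) by (induction w) auto
qed

lemma word_eval_cong:
  assumes "\<And>i. i \<in> fst ` set w \<Longrightarrow> g i = g' i"
  shows "word_eval G g w = word_eval G g' w"
  using assms by (induction G g w rule: word_eval.induct) force+

lemma word_eval_hom:
  assumes "group_hom G H h" "\<And>i. g i \<in> carrier G"
  shows "h (word_eval G g w) = word_eval H (\<lambda>i. h (g i)) w"
proof -
  interpret group_hom G H h by fact
  show ?thesis
  proof (induction w)
    case (Cons l w)
    then show ?case
      using assms(2) word_eval_closed[OF G.is_group, of g w]
      by (cases l) (auto simp: hom_mult hom_inv)
  qed simp
qed

lemma word_eval_append:
  assumes "group G" "\<And>i. g i \<in> carrier G"
  shows "word_eval G g (u @ v) = word_eval G g u \<otimes>\<^bsub>G\<^esub> word_eval G g v"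
proof -
  interpret group G by fact
  show ?thesis
    using assms(2) word_eval_closed[OF assms]
    by (induction u) (auto simp: m_assoc)
qed

lemma word_eval_subgroup:
  assumes "group G" "subgroup H G" "\<And>i. g i \<in> H"
  shows "word_eval (G\<lparr>carrier := H\<rparr>) g w = word_eval G g w"
  using assms by (induction w) (auto simp: group.m_inv_consistent)

lemma word_values_subset:
  "group G \<Longrightarrow> word_values G w \<subseteq> carrier G"
  by (auto simp: word_values_def word_eval_closed)

text \<open>Surjectivity lets an assignment in \<open>H\<close> be lifted variable by variable; the
  homomorphism carries the value of the lift to the given value.\<close>

lemma word_values_image:
  assumes "group_hom G H h" "h ` carrier G = carrier H"
  shows "word_values H w = h ` word_values G w"
proof (intro equalityI subsetI)
  fix y assume "y \<in> word_values H w"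
  then obtain g where g: "y = word_eval H g w" "\<And>i. g i \<in> carrier H"
    by (auto simp: word_values_def)
  define g' where "g' i = inv_into (carrier G) h (g i)" for i
  have g': "g' i \<in> carrier G" "h (g' i) = g i" for i
    using g(2)[of i] unfolding assms(2)[symmetric] g'_def
    by (auto simp: inv_into_into f_inv_into_f)
  have "y = h (word_eval G g' w)"
    using word_eval_hom[OF assms(1) g'(1)] by (simp add: g' g)
  then show "y \<in> h ` word_values G w"
    using g'(1) unfolding word_values_def by blast
next
  fix y assume "y \<in> h ` word_values G w"
  then obtain g where "y = h (word_eval G g w)" "\<And>i. g i \<in> carrier G"
    by (auto simp: word_values_def)
  moreover have "h (g i) \<in> carrier H" if "g i \<in> carrier G" for i and g :: "nat \<Rightarrow> _"
    using that assms(2) by blast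
  ultimately show "y \<in> word_values H w"
    using word_eval_hom[OF assms(1)] unfolding word_values_def by blast
qed

lemma verbal_subgroup_image:
  assumes "group_hom G H h" "h ` carrier G = carrier H"
  shows "verbal_subgroup H w = h ` verbal_subgroup G w"
proof -
  interpret group_hom G H h by fact
  show ?thesis
    by (simp add: verbal_subgroup_def word_values_image[OF assms] generate_img word_values_subset)
qed

lemma verbal_subgroup_subset:
  "group G \<Longrightarrow> verbal_subgroup G w \<subseteq> carrier G"
  by (simp add: verbal_subgroup_def group.generate_incl word_values_subset)

lemma word_values_subgroup_subset:
  assumes "group G" "subgroup H G"
  shows "word_values (G\<lparr>carrier := H\<rparr>) w \<subseteq> word_values G w"
proof
  interpret H: subgroup H G by fact
  fix y assume "y \<in> word_values (G\<lparr>carrier := H\<rparr>) w"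
  then obtain g where g: "y = word_eval (G\<lparr>carrier := H\<rparr>) g w" "\<And>i. g i \<in> H"
    by (auto simp: word_values_def)
  then have "y = word_eval G g w" "\<forall>i. g i \<in> carrier G"
    using word_eval_subgroup[OF assms, of g w] H.subset by auto
  then show "y \<in> word_values G w" unfolding word_values_def by blast
qed

text \<open>Once the values of \<open>G\<close> lie in \<open>H\<close>, they generate the same set
  inside \<open>H\<close> and inside \<open>G\<close>.\<close>

lemma verbal_subgroup_eq_if_word_values_eq:
  assumes "group G" "subgroup H G" and eq: "word_values (G\<lparr>carrier := H\<rparr>) w = word_values G w"
  shows "verbal_subgroup (G\<lparr>carrier := H\<rparr>) w = verbal_subgroup G w"
proof -
  have "word_values G w \<subseteq> H"
    using word_values_subset[OF subgroup.subgroup_is_group[OF assms(2,1)], of w] unfolding eq by simp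
  then have "generate (G\<lparr>carrier := H\<rparr>) (word_values G w) = generate G (word_values G w)"
    by (rule group.generate_consistent[OF assms(1) _ assms(2)])
  then show ?thesis unfolding verbal_subgroup_def eq .
qed

section \<open>Copies of groups on other types\<close>

text \<open>Transport of structure along an injection. Conciseness and the bounds below refer to
  fixed element types, so quotients, fibre products and subgroups have to be copied onto
  them.\<close>

lemma image_group_iso:
  assumes "group G" "inj_on f (carrier G)"
  shows "group (image_group f G)" "f \<in> iso G (image_group f G)"
proof -
  interpret group G by fact
  \<comment> \<open>For the trivial subgroup, the defining condition of a weak morphism amounts to
    injectivity.\<close>
  have *: "weak_group_morphism f {\<one>\<^bsub>G\<^esub>} G"
  proof (rule weak_group_morphismsI)
    fix a b assume "a \<in> carrier G" "b \<in> carrier G"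
    then show "f a = f b \<longleftrightarrow> a \<otimes>\<^bsub>G\<^esub> inv\<^bsub>G\<^esub> b \<in> {\<one>\<^bsub>G\<^esub>}"
      using assms(2) by (auto simp: inj_on_def) (metis inv_solve_right l_one one_closed)+
  qed (simp add: one_is_normal)
  show "group (image_group f G)" using image_group_is_group[OF *] .
  show "f \<in> iso G (image_group f G)"
    using weak_group_morphism_is_hom[OF *] assms(2)
    by (auto simp: iso_def bij_betw_def image_group_carrier)
qed

lemma finite_group_iso_nat:
  assumes "group G" "finite (carrier G)"
  obtains G' :: "nat monoid" and h where "group G'" "h \<in> iso G G'"
proof -
  obtain f :: "_ \<Rightarrow> nat" where "inj_on f (carrier G)"
    using finite_imp_inj_to_nat_seg[OF assms(2)] by blast
  then show thesis using image_group_iso[OF assms(1)] that by blast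
qed

section \<open>Finite covers through which the word map factors\<close>

text \<open>The situation of a finite quotient \<open>Q = G/N\<close> over
  \<open>F = G/N\<^sub>0\<close>, stated without \<open>G\<close>: the last conjunct says that the
  word map on \<open>Q\<close> factors through \<open>\<phi>\<close>. Finiteness of \<open>Q\<close>
  keeps \<open>card\<close> of its verbal subgroup meaningful.\<close>

definition value_cover ::
    "group_word \<Rightarrow> ('a, 'm) monoid_scheme \<Rightarrow> ('f, 'n) monoid_scheme \<Rightarrow> ('a \<Rightarrow> 'f) \<Rightarrow> bool" where
  "value_cover w Q F \<phi> \<longleftrightarrow> group_hom Q F \<phi> \<and> finite (carrier Q) \<and> \<phi> ` carrier Q = carrier F \<and>
     (\<forall>g g'. (\<forall>i. g i \<in> carrier Q) \<longrightarrow> (\<forall>i. g' i \<in> carrier Q) \<longrightarrow> (\<forall>i. \<phi> (g i) = \<phi> (g' i)) \<longrightarrow>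
        word_eval Q g w = word_eval Q g' w)"

lemma value_coverI:
  assumes "group_hom Q F \<phi>" "finite (carrier Q)" "\<phi> ` carrier Q = carrier F"
    and "\<And>g g'. (\<And>i. g i \<in> carrier Q) \<Longrightarrow> (\<And>i. g' i \<in> carrier Q) \<Longrightarrow> (\<And>i. \<phi> (g i) = \<phi> (g' i)) \<Longrightarrow>
      word_eval Q g w = word_eval Q g' w"
  shows "value_cover w Q F \<phi>"
  unfolding value_cover_def by (intro conjI allI impI assms) auto

lemma value_coverD:
  assumes "value_cover w Q F \<phi>"
  shows "group_hom Q F \<phi>" "finite (carrier Q)" "\<phi> ` carrier Q = carrier F"
    and "(\<And>i. g i \<in> carrier Q) \<Longrightarrow> (\<And>i. g' i \<in> carrier Q) \<Longrightarrow> (\<And>i. \<phi> (g i) = \<phi> (g' i)) \<Longrightarrow>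
      word_eval Q g w = word_eval Q g' w"
proof -
  note * = assms[unfolded value_cover_def]
  show "group_hom Q F \<phi>" "finite (carrier Q)" "\<phi> ` carrier Q = carrier F"
    using * by simp_all
  assume "\<And>i. g i \<in> carrier Q" "\<And>i. g' i \<in> carrier Q" "\<And>i. \<phi> (g i) = \<phi> (g' i)"
  then have "(\<forall>i. g i \<in> carrier Q) \<and> (\<forall>i. g' i \<in> carrier Q) \<and> (\<forall>i. \<phi> (g i) = \<phi> (g' i))"
    by blast
  then show "word_eval Q g w = word_eval Q g' w" using * by blast
qed

text \<open>Since \<open>H\<close> maps onto \<open>F\<close>, every assignment in \<open>Q\<close>
  can be replaced by one in \<open>H\<close> with the same images in \<open>F\<close>, and this
  leaves the value unchanged. So \<open>H\<close> and \<open>Q\<close> have the same word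
  values.\<close>

lemma value_cover_subgroup:
  assumes "value_cover w Q F \<phi>" "subgroup H Q" "\<phi> ` H = carrier F"
  shows "value_cover w (Q\<lparr>carrier := H\<rparr>) F \<phi>"
    and "verbal_subgroup (Q\<lparr>carrier := H\<rparr>) w = verbal_subgroup Q w"
proof -
  note cover = value_coverD[OF assms(1)]
  interpret group_hom Q F \<phi> by (rule cover)
  interpret H: subgroup H Q by fact
  interpret QH: group "Q\<lparr>carrier := H\<rparr>" by (rule H.subgroup_is_group) (rule G.is_group)
  note eval = word_eval_subgroup[OF G.is_group assms(2)]
  show "value_cover w (Q\<lparr>carrier := H\<rparr>) F \<phi>"
  proof (rule value_coverI)
    show "group_hom (Q\<lparr>carrier := H\<rparr>) F \<phi>" by unfold_locales (auto simp: hom_def)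
    show "finite (carrier (Q\<lparr>carrier := H\<rparr>))"
      using cover(2) H.subset by (auto intro: finite_subset)
    show "\<phi> ` carrier (Q\<lparr>carrier := H\<rparr>) = carrier F" using assms(3) by simp
    fix g g' :: "nat \<Rightarrow> _"
    assume g: "\<And>i. g i \<in> carrier (Q\<lparr>carrier := H\<rparr>)" and g': "\<And>i. g' i \<in> carrier (Q\<lparr>carrier := H\<rparr>)"
      and gg': "\<And>i. \<phi> (g i) = \<phi> (g' i)"
    have "word_eval Q g w = word_eval Q g' w"
      by (rule cover(4)) (use g g' gg' in simp_all)
    then show "word_eval (Q\<lparr>carrier := H\<rparr>) g w = word_eval (Q\<lparr>carrier := H\<rparr>) g' w"
      using g g' by (simp add: eval)
  qed
  have "word_values Q w \<subseteq> word_values (Q\<lparr>carrier := H\<rparr>) w"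
  proof
    fix y assume "y \<in> word_values Q w"
    then obtain g where g: "y = word_eval Q g w" "\<And>i. g i \<in> carrier Q"
      by (auto simp: word_values_def)
    have "\<exists>h\<in>H. \<phi> h = \<phi> (g i)" for i
      using hom_closed[OF g(2)[of i]] assms(3) by (metis imageE)
    then obtain g' :: "nat \<Rightarrow> _" where g': "\<And>i. g' i \<in> H" "\<And>i. \<phi> (g' i) = \<phi> (g i)"
      by metis
    have "word_eval Q g w = word_eval Q g' w"
      by (rule cover(4)) (simp_all add: g g')
    then have "y = word_eval (Q\<lparr>carrier := H\<rparr>) g' w"
      using g eval[OF g'(1)] by simp
    then show "y \<in> word_values (Q\<lparr>carrier := H\<rparr>) w"
      using g'(1) unfolding word_values_def mem_Collect_eq by (intro exI[of _ g']) simp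
  qed
  then have "word_values (Q\<lparr>carrier := H\<rparr>) w = word_values Q w"
    using word_values_subgroup_subset[OF G.is_group assms(2)] by (rule equalityI[rotated])
  then show "verbal_subgroup (Q\<lparr>carrier := H\<rparr>) w = verbal_subgroup Q w"
    by (rule verbal_subgroup_eq_if_word_values_eq[OF G.is_group assms(2)])
qed

text \<open>By \<open>eq\<close> the kernel of \<open>h\<close> lies in that of
  \<open>\<phi>\<close>, so \<open>\<phi>\<close> factors through \<open>h\<close>; the dependence
  of values on images in \<open>F\<close> is then pushed forward from \<open>G\<close>, which may be
  infinite.\<close>

lemma value_cover_of_quotient:
  assumes "group_hom G F \<phi>" "\<phi> ` carrier G = carrier F"
    and determined: "\<And>g g'. (\<And>i. g i \<in> carrier G) \<Longrightarrow> (\<And>i. g' i \<in> carrier G) \<Longrightarrow>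
      (\<And>i. \<phi> (g i) = \<phi> (g' i)) \<Longrightarrow> word_eval G g w = word_eval G g' w"
    and "group_hom G Q h" "h ` carrier G = carrier Q" "finite (carrier Q)"
    and eq: "\<And>x y. x \<in> carrier G \<Longrightarrow> y \<in> carrier G \<Longrightarrow> h x = h y \<Longrightarrow> \<phi> x = \<phi> y"
  obtains \<psi> where "value_cover w Q F \<psi>"
proof -
  interpret \<phi>: group_hom G F \<phi> by fact
  interpret h: group_hom G Q h by fact
  define l where "l = inv_into (carrier G) h"
  have l: "l y \<in> carrier G" "h (l y) = y" if "y \<in> carrier Q" for y
    using that unfolding assms(5)[symmetric] l_def by (auto simp: inv_into_into f_inv_into_f)
  define \<psi> where "\<psi> y = \<phi> (l y)" for y
  have \<psi>: "\<psi> (h x) = \<phi> x" if "x \<in> carrier G" for x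
    unfolding \<psi>_def using l[of "h x"] that by (intro eq) auto
  have "group_hom Q F \<psi>"
  proof (unfold_locales, rule homI)
    fix y assume "y \<in> carrier Q"
    then show "\<psi> y \<in> carrier F" using l by (simp add: \<psi>_def)
  next
    fix y z assume "y \<in> carrier Q" "z \<in> carrier Q"
    then have yz: "y \<otimes>\<^bsub>Q\<^esub> z = h (l y \<otimes>\<^bsub>G\<^esub> l z)" "l y \<in> carrier G" "l z \<in> carrier G"
      using l by (simp_all add: h.hom_mult)
    have "\<psi> (y \<otimes>\<^bsub>Q\<^esub> z) = \<phi> (l y \<otimes>\<^bsub>G\<^esub> l z)"
      unfolding yz(1) by (rule \<psi>) (use yz in simp)
    then show "\<psi> (y \<otimes>\<^bsub>Q\<^esub> z) = \<psi> y \<otimes>\<^bsub>F\<^esub> \<psi> z"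
      using yz(2,3) by (simp add: \<psi>_def \<phi>.hom_mult)
  qed
  moreover note assms(6)
  moreover have "\<psi> ` carrier Q = carrier F"
  proof -
    have "\<psi> ` h ` carrier G = \<phi> ` carrier G"
      unfolding image_image by (intro image_cong \<psi> refl)
    then show ?thesis using assms(2,5) by simp
  qed
  moreover have "word_eval Q g w = word_eval Q g' w"
    if g: "\<And>i. g i \<in> carrier Q" and g': "\<And>i. g' i \<in> carrier Q"
      and gg': "\<And>i. \<psi> (g i) = \<psi> (g' i)" for g g'
  proof -
    have lift: "word_eval Q f w = h (word_eval G (\<lambda>i. l (f i)) w)" if "\<And>i. f i \<in> carrier Q" for f
      by (subst word_eval_hom[OF assms(4)]) (simp_all add: l that)
    have "word_eval G (\<lambda>i. l (g i)) w = word_eval G (\<lambda>i. l (g' i)) w"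
      by (rule determined) (simp_all add: l g g' gg'[unfolded \<psi>_def])
    then show ?thesis unfolding lift[OF g] lift[OF g'] by (rule arg_cong)
  qed
  ultimately have "value_cover w Q F \<psi>" by (rule value_coverI)
  then show thesis by (rule that)
qed

section \<open>Finite \<open>p\<close>-groups and Sylow subgroups\<close>


lemma (in group_hom) order_eq_order_kernel:
  assumes "finite (carrier G)" "h ` carrier G = carrier H"
  shows "order G = order H * card (kernel G H h)"
proof -
  have "card (rcosets\<^bsub>G\<^esub> kernel G H h) = order H"
    using FactGroup_iso_set[OF assms(2)] unfolding iso_def order_def FactGroup_def
    by (auto dest: bij_betw_same_card)
  then show ?thesis
    using G.lagrange[OF subgroup_kernel] by simp
qed

text \<open>An orbit with more than one point has size a power of \<open>p\<close> divisible by
  \<open>p\<close>; without fixed points, \<open>p\<close> would divide \<open>card X\<close>. The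
  action is a plain function \<open>f\<close>, ready for conjugation and for translation of
  cosets.\<close>

lemma p_group_fixed_point:
  fixes P (structure)
  assumes "group P" "prime p" "order P = p ^ a" "finite X" "\<not> p dvd card X"
    and closed: "\<And>g x. g \<in> carrier P \<Longrightarrow> x \<in> X \<Longrightarrow> f g x \<in> X"
    and one: "\<And>x. x \<in> X \<Longrightarrow> f \<one> x = x"
    and mult: "\<And>g h x. g \<in> carrier P \<Longrightarrow> h \<in> carrier P \<Longrightarrow> x \<in> X \<Longrightarrow> f (g \<otimes> h) x = f g (f h x)"
  obtains x where "x \<in> X" "\<And>g. g \<in> carrier P \<Longrightarrow> f g x = x"
proof -
  interpret group P by fact
  \<comment> \<open>The elements of \<open>BijGroup X\<close> are extensional functions, hence the
    restriction.\<close>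
  define \<phi> where "\<phi> g = restrict (f g) X" for g
  have bij: "\<phi> g \<in> Bij X" if g: "g \<in> carrier P" for g
  proof -
    have "bij_betw (\<phi> g) X X"
      by (rule bij_betw_byWitness[where f' = "\<phi> (inv g)"])
        (use g closed one in \<open>auto simp: \<phi>_def mult[symmetric]\<close>)
    then show ?thesis by (auto simp: Bij_def \<phi>_def)
  qed
  have "\<phi> \<in> hom P (BijGroup X)"
  proof (rule homI)
    fix g h assume "g \<in> carrier P" "h \<in> carrier P"
    then show "\<phi> (g \<otimes> h) = \<phi> g \<otimes>\<^bsub>BijGroup X\<^esub> \<phi> h"
      using bij by (auto simp: BijGroup_def \<phi>_def compose_def mult closed fun_eq_iff)
  qed (use bij in \<open>auto simp: BijGroup_def\<close>)
  then interpret A: group_action P X \<phi>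
    by (simp add: group_action_def group_hom_def group_hom_axioms_def is_group group_BijGroup)
  show thesis
  proof (rule ccontr)
    assume "\<not> thesis"
    then have nofix: "\<forall>x\<in>X. \<exists>g\<in>carrier P. f g x \<noteq> x" using that by blast
    have "p dvd card c" if c: "c \<in> orbits P X \<phi>" for c
    proof -
      obtain x where x: "x \<in> X" "c = orbit P \<phi> x" using c by (auto simp: orbits_def)
      obtain g where g: "g \<in> carrier P" "f g x \<noteq> x" using nofix x(1) by blast
      have "card c dvd p ^ a"
        using A.orbit_stabilizer_theorem[OF x(1)] x(2) assms(3) by (metis dvd_triv_left)
      then obtain i where i: "card c = p ^ i" using divides_primepow_nat[OF assms(2)] by blast
      have "i \<noteq> 0"
      proof
        assume "i = 0"
        then have "card c = 1" using i by simp
        then obtain y where "c = {y}" using card_1_singletonE by blast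
        moreover have "x \<in> c" using A.orbit_refl[OF x(1)] x(2) by simp
        moreover have "f g x \<in> c" using x g by (auto simp: orbit_def \<phi>_def)
        ultimately show False using g by auto
      qed
      then show ?thesis using i by simp
    qed
    moreover have "\<Union> (orbits P X \<phi>) = X" by (rule A.orbits_coverture)
    moreover have "c1 \<inter> c2 = {}" if "c1 \<in> orbits P X \<phi>" "c2 \<in> orbits P X \<phi>" "c1 \<noteq> c2" for c1 c2
      using A.disjoint_union[OF that(1,2)] that(3) by blast
    ultimately have "p dvd card X"
      using dvd_partition[of "orbits P X \<phi>" p] assms(4) by auto
    then show False using assms(5) by simp
  qed
qed

text \<open>\<open>P\<close> acts by conjugation on its \<open>p ^ a - 1\<close> elements other than
  the identity, a number prime to \<open>p\<close>; a fixed point is central.\<close>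

lemma p_group_center_nontrivial:
  fixes P (structure)
  assumes "group P" "prime p" "order P = p ^ a" "a > 0"
  obtains z where "z \<in> carrier P" "z \<noteq> \<one>" "\<And>y. y \<in> carrier P \<Longrightarrow> y \<otimes> z = z \<otimes> y"
proof -
  interpret group P by fact
  have pos: "p ^ a > 0" using assms(2) by (simp add: prime_gt_0_nat)
  then have fin: "finite (carrier P)" using assms(3) order_gt_0_iff_finite by simp
  have "\<not> p dvd card (carrier P - {\<one>})"
  proof
    assume "p dvd card (carrier P - {\<one>})"
    then have "p dvd p ^ a - 1" using assms(3) fin by (simp add: order_def)
    moreover have "p dvd p ^ a" using assms(4) by simp
    ultimately have "p dvd 1" using pos by (metis Suc_leI One_nat_def dvd_diffD1)
    then show False using assms(2) by (metis not_prime_unit)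
  qed
  then obtain z where z: "z \<in> carrier P - {\<one>}"
    "\<And>y. y \<in> carrier P \<Longrightarrow> y \<otimes> z \<otimes> inv y = z"
  proof (rule p_group_fixed_point[OF assms(1-3), of "carrier P - {\<one>}" "\<lambda>y z. y \<otimes> z \<otimes> inv y", rotated])
    fix g h x assume "g \<in> carrier P" "h \<in> carrier P" "x \<in> carrier P - {\<one>}"
    then show "g \<otimes> h \<otimes> x \<otimes> inv (g \<otimes> h) = g \<otimes> (h \<otimes> x \<otimes> inv h) \<otimes> inv g"
      by (simp add: inv_mult_group m_assoc)
  next
    fix g x assume gx: "g \<in> carrier P" "x \<in> carrier P - {\<one>}"
    have "g \<otimes> x \<otimes> inv g \<noteq> \<one>"
    proof
      assume "g \<otimes> x \<otimes> inv g = \<one>"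
      then have "g \<otimes> x = g" using gx by (metis DiffD1 inv_closed inv_inv inv_solve_right' l_one m_closed one_closed)
      then show False using gx by simp
    qed
    then show "g \<otimes> x \<otimes> inv g \<in> carrier P - {\<one>}" using gx by simp
  qed (use fin in auto)
  have "y \<otimes> z = z \<otimes> y" if "y \<in> carrier P" for y
    using z that by (metis DiffD1 inv_solve_right' m_closed)
  then show thesis using z that by blast
qed

text \<open>Let \<open>L\<close> be a proper normal subgroup of largest order. The preimage
  \<open>C\<close> of the centre of \<open>P Mod L\<close> is normal and strictly larger than
  \<open>L\<close>, hence all of \<open>P\<close>. So \<open>P Mod L\<close> is abelian and
  \<open>L\<close> contains the derived subgroup.\<close>

lemma p_group_derived_proper:
  fixes P (structure)
  assumes "group P" "prime p" "order P = p ^ a" "a > 0"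
  shows "derived P (carrier P) \<noteq> carrier P"
proof -
  interpret group P by fact
  have "p ^ a > 1" using assms(2,4) by (intro one_less_power prime_gt_1_nat)
  then have "order P > 1" unfolding assms(3) .
  then have fin: "finite (carrier P)" using order_gt_0_iff_finite by linarith
  have "{\<one>} \<noteq> carrier P" using \<open>order P > 1\<close> by (metis card.empty card_insert_disjoint empty_iff finite.emptyI less_irrefl One_nat_def order_def)
  then have "\<exists>L. L \<lhd> P \<and> L \<noteq> carrier P" using one_is_normal by blast
  \<comment> \<open>The existence of a maximum is derived from a strict bound, hence
    \<open>Suc\<close>.\<close>
  moreover have "\<forall>L. L \<lhd> P \<and> L \<noteq> carrier P \<longrightarrow> card L < Suc (order P)"
    using fin by (auto simp: order_def less_Suc_eq_le intro!: card_mono dest: normal_imp_subgroup subgroup.subset)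
  ultimately obtain L where L: "L \<lhd> P" "L \<noteq> carrier P"
    and max: "\<And>K. K \<lhd> P \<Longrightarrow> K \<noteq> carrier P \<Longrightarrow> card K \<le> card L"
    using ex_has_greatest_nat[of "\<lambda>L. L \<lhd> P \<and> L \<noteq> carrier P" _ card "Suc (order P)"] by blast
  interpret L: normal L P by fact
  have com_iff: "x \<otimes> y \<otimes> inv x \<otimes> inv y \<in> L \<longleftrightarrow> L #> (x \<otimes> y) = L #> (y \<otimes> x)"
    if "x \<in> carrier P" "y \<in> carrier P" for x y
  proof -
    have "x \<otimes> y \<otimes> inv x \<otimes> inv y = (x \<otimes> y) \<otimes> inv (y \<otimes> x)"
      using that by (simp add: inv_mult_group m_assoc)
    then show ?thesis using that L.subgroup_axioms
      by (metis L.rcos_module_imp L.rcos_module_rev is_group m_closed rcos_self repr_independence repr_independenceD)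
  qed
  \<comment> \<open>The preimage of the centre of \<open>P Mod L\<close>, written with commutators;
    \<open>com_iff\<close> turns the condition into an equality of cosets.\<close>
  define C where "C = {x \<in> carrier P. \<forall>y\<in>carrier P. x \<otimes> y \<otimes> inv x \<otimes> inv y \<in> L}"
  have C: "C = {x \<in> carrier P. \<forall>y\<in>carrier P. L #> (x \<otimes> y) = L #> (y \<otimes> x)}"
    unfolding C_def using com_iff by blast
  have ord: "order (P Mod L) * card L = p ^ a"
    using lagrange[OF L.subgroup_axioms] assms(3) by (simp add: order_def FactGroup_def)
  then obtain b where b: "order (P Mod L) = p ^ b"
    using divides_primepow_nat[OF assms(2)] ord by (metis dvd_triv_left)
  have "b \<noteq> 0"
  proof
    assume "b = 0"
    then have "card L = order P" using b ord assms(3) by simp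
    then show False using fin L(2) L.subset by (simp add: order_def card_subset_eq)
  qed
  then obtain Z where Z: "Z \<in> carrier (P Mod L)" "Z \<noteq> \<one>\<^bsub>P Mod L\<^esub>"
    and Zc: "\<And>Y. Y \<in> carrier (P Mod L) \<Longrightarrow> Y \<otimes>\<^bsub>P Mod L\<^esub> Z = Z \<otimes>\<^bsub>P Mod L\<^esub> Y"
    using p_group_center_nontrivial[OF L.factorgroup_is_group assms(2) b] by blast
  obtain z where z: "z \<in> carrier P" "Z = L #> z" using Z(1) by (auto simp: carrier_FactGroup)
  have "L #> (y \<otimes> z) = L #> (z \<otimes> y)" if "y \<in> carrier P" for y
    using Zc[of "L #> y"] that z by (auto simp: carrier_FactGroup L.rcos_sum)
  then have "z \<in> C" using z by (simp add: C)
  have "z \<notin> L" using Z(2) z L.rcos_const[OF is_group] by auto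
  have "subgroup C P"
  proof (rule subgroupI)
    show "C \<noteq> {}" using \<open>z \<in> C\<close> by blast
    fix x assume x: "x \<in> C"
    have "L #> (inv x \<otimes> y) = L #> (y \<otimes> inv x)" if y: "y \<in> carrier P" for y
    proof -
      have xc: "x \<in> carrier P" using x by (simp add: C)
      have "(L #> (inv x)) <#> ((L #> (x \<otimes> (y \<otimes> inv x)))) = (L #> (inv x)) <#> (L #> ((y \<otimes> inv x) \<otimes> x))"
        using x y by (simp add: C)
      then show ?thesis using xc y by (simp add: L.rcos_sum m_assoc) (simp add: m_assoc[symmetric])
    qed
    then show "inv x \<in> C" using x by (simp add: C)
    fix x' assume x': "x' \<in> C"
    have "L #> (x \<otimes> x' \<otimes> y) = L #> (y \<otimes> (x \<otimes> x'))" if y: "y \<in> carrier P" for y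
    proof -
      have xc: "x \<in> carrier P" "x' \<in> carrier P" using x x' by (simp_all add: C)
      have "L #> (x \<otimes> x' \<otimes> y) = (L #> x) <#> (L #> (x' \<otimes> y))"
        using xc y by (simp add: L.rcos_sum m_assoc)
      also have "\<dots> = (L #> x) <#> (L #> (y \<otimes> x'))" using x' y by (simp add: C)
      also have "\<dots> = (L #> (x \<otimes> y)) <#> (L #> x')" using xc y by (simp add: L.rcos_sum m_assoc)
      also have "\<dots> = (L #> (y \<otimes> x)) <#> (L #> x')" using x y by (simp add: C)
      also have "\<dots> = L #> (y \<otimes> (x \<otimes> x'))" using xc y by (simp add: L.rcos_sum m_assoc)
      finally show ?thesis .
    qed
    then show "x \<otimes> x' \<in> C" using x x' by (simp add: C)
  qed (auto simp: C_def)
  moreover have LC: "L \<subseteq> C"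
  proof
    fix x assume x: "x \<in> L"
    have "x \<otimes> (y \<otimes> inv x \<otimes> inv y) \<in> L" if "y \<in> carrier P" for y
      using x that by (intro L.m_closed L.inv_op_closed2) auto
    then show "x \<in> C" using x L.subset by (auto simp: C_def m_assoc)
  qed
  moreover have "g \<otimes> x \<otimes> inv g \<in> C" if "g \<in> carrier P" "x \<in> C" for g x
  proof -
    have xc: "x \<in> carrier P" using that by (simp add: C)
    have "L #> (x \<otimes> inv g) = L #> (inv g \<otimes> x)" using that by (simp add: C)
    then have "L #> (g \<otimes> x \<otimes> inv g) = L #> x"
      using that xc by (metis L.rcos_sum inv_closed l_one m_assoc m_closed r_inv)
    then have "g \<otimes> x \<otimes> inv g \<in> L #> x" using that xc rcos_self[OF _ L.subgroup_axioms] by (metis inv_closed m_closed)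
    then obtain l where "l \<in> L" "g \<otimes> x \<otimes> inv g = l \<otimes> x" by (auto simp: r_coset_def)
    then show ?thesis using LC that \<open>subgroup C P\<close> by (metis subgroup.m_closed subsetD)
  qed
  ultimately have "C \<lhd> P" by (simp add: normal_inv_iff)
  moreover have "card L < card C"
    using \<open>z \<in> C\<close> \<open>z \<notin> L\<close> LC fin by (intro psubset_card_mono) (auto simp: C_def)
  ultimately have "C = carrier P" using max[of C] by force
  then have "derived_set P (carrier P) \<subseteq> L" by (auto simp: C_def)
  then have "derived P (carrier P) \<subseteq> L"
    unfolding derived_def by (intro generate_subgroup_incl L.subgroup_axioms)
  then show ?thesis using L(2) L.subset by auto
qed

text \<open>\<open>P\<close> acts by right translation on the \<open>m\<close> cosets of
  \<open>S\<close>, and \<open>m\<close> is prime to \<open>p\<close>. A fixed coset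
  \<open>S #> x\<close> satisfies \<open>S #> (x \<otimes> y) = S #> x\<close> for all
  \<open>y\<close> in \<open>P\<close>, which is the claim for this \<open>x\<close>.\<close>

lemma sylow_conjugate:
  fixes M (structure)
  assumes "group M" "prime p" "order M = p ^ a * m" "\<not> p dvd m"
    and "subgroup S M" "card S = p ^ a" "subgroup P M" "card P = p ^ b"
  obtains x where "x \<in> carrier M" "\<And>y. y \<in> P \<Longrightarrow> x \<otimes> y \<otimes> inv x \<in> S"
proof -
  interpret group M by fact
  interpret S: subgroup S M by fact
  interpret P: subgroup P M by fact
  have pos: "p ^ a > 0" using assms(2) by (simp add: prime_gt_0_nat)
  have "m > 0" using assms(4) by (cases "m = 0") auto
  then have fin: "finite (carrier M)" using pos assms(3) order_gt_0_iff_finite by simp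
  have "card (rcosets S) = m"
    using lagrange[OF assms(5)] prime_gt_0_nat[OF assms(2)] unfolding assms(3,6) by simp
  then have nd: "\<not> p dvd card (rcosets S)" using assms(4) by simp
  have P: "group (M\<lparr>carrier := P\<rparr>)" "order (M\<lparr>carrier := P\<rparr>) = p ^ b"
    using P.subgroup_is_group[OF is_group] assms(8) by (simp_all add: order_def)
  \<comment> \<open>The inverse turns right translation into a left action.\<close>
  obtain C where C: "C \<in> rcosets S" "\<And>g. g \<in> P \<Longrightarrow> C #> inv g = C"
  proof (rule p_group_fixed_point[OF P(1) assms(2) P(2) _ nd, of "\<lambda>g C. C #> inv g"])
    show "finite (rcosets S)" using fin by (simp add: RCOSETS_def)
    have sub: "C \<subseteq> carrier M" if "C \<in> rcosets S" for C using that by (rule S.rcosets_carrier[OF is_group])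
    fix g C assume gC: "g \<in> carrier (M\<lparr>carrier := P\<rparr>)" "C \<in> rcosets S"
    then obtain x where x: "x \<in> carrier M" "C = S #> x" by (auto simp: RCOSETS_def)
    then have "C #> inv g = S #> (x \<otimes> inv g)" using gC by (simp add: coset_mult_assoc S.subset)
    then show "C #> inv g \<in> rcosets S" using x gC by (auto simp: RCOSETS_def)
    fix h assume "h \<in> carrier (M\<lparr>carrier := P\<rparr>)"
    then show "C #> inv (g \<otimes>\<^bsub>M\<lparr>carrier := P\<rparr>\<^esub> h) = C #> inv h #> inv g"
      using gC sub by (simp add: inv_mult_group coset_mult_assoc)
  next
    fix C assume "C \<in> rcosets S"
    then show "C #> inv \<one>\<^bsub>M\<lparr>carrier := P\<rparr>\<^esub> = C"
      using S.rcosets_carrier[OF is_group] by (simp add: coset_mult_one)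
  qed auto
  then obtain x where x: "x \<in> carrier M" "C = S #> x" by (auto simp: RCOSETS_def)
  have "x \<otimes> y \<otimes> inv x \<in> S" if y: "y \<in> P" for y
  proof -
    have "x \<otimes> y \<in> S #> x"
      using C(2)[of "inv y"] x y rcos_self[of "x \<otimes> y" S] by (simp add: coset_mult_assoc S.subset assms(5))
    then show ?thesis using x y by (simp add: S.rcos_module is_group)
  qed
  then show thesis using x that by blast
qed

section \<open>Complements of abelian normal subgroups of coprime index\<close>

lemma (in comm_group) finprod_hom:
  assumes "h \<in> hom G G" "f \<in> X \<rightarrow> carrier G"
  shows "h (finprod G f X) = finprod G (\<lambda>x. h (f x)) X"
  using assms(2)
proof (induction X rule: infinite_finite_induct)
  case (insert x X)
  moreover have "h y \<in> carrier G" if "y \<in> carrier G" for y using assms(1) that by (rule hom_in_carrier)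
  ultimately show ?case using assms(1) by (simp add: hom_mult Pi_def)
qed (use hom_one[OF assms(1)] is_group in auto)

text \<open>The complement is the kernel of the crossed homomorphism \<open>d\<close> into \<open>A\<close> that multiplies up the
  discrepancies of a transversal \<open>s\<close> under left translation; on \<open>A\<close> itself \<open>d\<close> is the power map with
  exponent the index of \<open>A\<close>, hence bijective.\<close>

lemma abelian_normal_coprime_complement:
  fixes Q (structure)
  assumes "A \<lhd> Q" "finite (carrier Q)"
    and comm: "\<And>x y. x \<in> A \<Longrightarrow> y \<in> A \<Longrightarrow> x \<otimes> y = y \<otimes> x"
    and cop: "coprime (card A) (card (rcosets A))"
  obtains C where "subgroup C Q" "C \<inter> A = {\<one>}" "\<And>x. x \<in> carrier Q \<Longrightarrow> \<exists>a\<in>A. a \<otimes> x \<in> C"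
proof -
  interpret normal A Q by fact
  let ?A = "Q\<lparr>carrier := A\<rparr>"
  interpret A: comm_group ?A
    by (rule group.group_comm_groupI) (use subgroup_is_group is_group comm in auto)
  have powA: "a [^]\<^bsub>?A\<^esub> k = a [^] k" for a and k :: nat
    by (rule nat_pow_consistent[symmetric])
  define n where "n = card (rcosets A)"
  \<comment> \<open>\<open>s\<close> chooses coset representatives, \<open>t x\<close> is the
    permutation of the cosets given by left translation, and \<open>c x X\<close> is the element of
    \<open>A\<close> by which \<open>x \<otimes> s X\<close> differs from the representative of its
    coset.\<close>
  define s where "s X = (SOME x. x \<in> X)" for X :: "'a set"
  define t where "t x X = A #> (x \<otimes> s X)" for x X
  define c where "c x X = x \<otimes> s X \<otimes> inv (s (t x X))" for x X
  define d where "d x = finprod ?A (c x) (rcosets A)" for x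
  have coset_left: "A #> (a \<otimes> x) = A #> x" if "a \<in> A" "x \<in> carrier Q" for a x
    using that by (metis coset_mult_assoc rcos_const is_group mem_carrier subset)
  have s: "s X \<in> carrier Q" "A #> s X = X" if X: "X \<in> rcosets A" for X
  proof -
    have "s X \<in> X" unfolding s_def using rcosets_non_empty[OF X] by (simp add: some_in_eq)
    moreover obtain x where "x \<in> carrier Q" "X = A #> x" using X by (auto simp: RCOSETS_def)
    ultimately show "s X \<in> carrier Q" "A #> s X = X"
      using elemrcos_carrier[OF is_group] repr_independence[OF _ _ subgroup_axioms] by blast+
  qed
  have t: "t x X \<in> rcosets A" if "x \<in> carrier Q" "X \<in> rcosets A" for x X
    using that s(1) by (auto simp: t_def intro: rcosetsI subset)
  have c: "c x X \<in> A" "x \<otimes> s X = c x X \<otimes> s (t x X)" if "x \<in> carrier Q" "X \<in> rcosets A" for x X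
  proof -
    note st = s[OF t[OF that]] s[OF that(2)]
    have "x \<otimes> s X \<in> A #> s (t x X)"
      using st(2) rcos_self[OF _ subgroup_axioms, of "x \<otimes> s X"] that st by (simp add: t_def)
    then show "c x X \<in> A" unfolding c_def using st that by (intro rcos_module_imp[OF is_group]) auto
    show "x \<otimes> s X = c x X \<otimes> s (t x X)"
      unfolding c_def using st that by (simp add: m_assoc)
  qed
  \<comment> \<open>Translation is an action, and the discrepancies obey a cocycle identity twisted
    by conjugation with \<open>x\<close>.\<close>
  have tt: "t (x \<otimes> y) X = t x (t y X)"
    and cc: "c (x \<otimes> y) X = (x \<otimes> c y X \<otimes> inv x) \<otimes> c x (t y X)"
    if xy: "x \<in> carrier Q" "y \<in> carrier Q" and X: "X \<in> rcosets A" for x y X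
  proof -
    note ty = t[OF xy(2) X]
    note tx = t[OF xy(1) ty]
    note sX = s(1)[OF X] s(1)[OF ty] s(1)[OF tx]
    note cy = c[OF xy(2) X]
    have cyQ: "c y X \<in> carrier Q" using cy(1) by (rule mem_carrier)
    have "x \<otimes> y \<otimes> s X = x \<otimes> (c y X \<otimes> s (t y X))"
      using xy sX cy(2) by (simp add: m_assoc)
    also have "\<dots> = (x \<otimes> c y X \<otimes> inv x) \<otimes> (x \<otimes> s (t y X))"
      using xy sX cyQ by (simp add: m_assoc) (simp add: m_assoc[symmetric])
    finally have eq: "x \<otimes> y \<otimes> s X = (x \<otimes> c y X \<otimes> inv x) \<otimes> (x \<otimes> s (t y X))" .
    show tt: "t (x \<otimes> y) X = t x (t y X)"
      unfolding t_def[of "x \<otimes> y"] eq t_def[of x "t y X"]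
      using inv_op_closed2[OF xy(1) cy(1)] xy sX by (intro coset_left) auto
    show "c (x \<otimes> y) X = (x \<otimes> c y X \<otimes> inv x) \<otimes> c x (t y X)"
      unfolding c_def[of "x \<otimes> y"] eq tt c_def[of x "t y X"] using xy sX cyQ by (simp add: m_assoc)
  qed
  have t1: "t \<one> X = X" if "X \<in> rcosets A" for X using s[OF that] by (simp add: t_def)
  have bij: "bij_betw (t y) (rcosets A) (rcosets A)" if y: "y \<in> carrier Q" for y
    by (rule bij_betw_byWitness[where f' = "t (inv y)"]) (use y t in \<open>auto simp: tt[symmetric] t1\<close>)
  have dA: "d x \<in> A" if "x \<in> carrier Q" for x
    using A.finprod_closed[of "c x" "rcosets A"] c(1)[OF that] by (auto simp: d_def)
  have conj_hom: "(\<lambda>a. x \<otimes> a \<otimes> inv x) \<in> hom ?A ?A" if x: "x \<in> carrier Q" for x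
  proof (rule homI)
    fix a b assume "a \<in> carrier ?A" "b \<in> carrier ?A"
    then show "x \<otimes> (a \<otimes>\<^bsub>?A\<^esub> b) \<otimes> inv x = x \<otimes> a \<otimes> inv x \<otimes>\<^bsub>?A\<^esub> (x \<otimes> b \<otimes> inv x)"
      using x by (simp add: m_assoc) (simp add: m_assoc[symmetric])
  qed (use x inv_op_closed2 in auto)
  \<comment> \<open>The product of the cocycle identity over all cosets: conjugation passes through
    the product, and the factors \<open>c x (t y X)\<close> are reindexed along the permutation
    \<open>t y\<close>.\<close>
  have dd: "d (x \<otimes> y) = (x \<otimes> d y \<otimes> inv x) \<otimes> d x" if xy: "x \<in> carrier Q" "y \<in> carrier Q" for x y
  proof -
    have "d (x \<otimes> y) = finprod ?A (\<lambda>X. (x \<otimes> c y X \<otimes> inv x) \<otimes>\<^bsub>?A\<^esub> c x (t y X)) (rcosets A)"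
      unfolding d_def using cc[OF xy] c t xy inv_op_closed2 by (intro A.finprod_cong') auto
    also have "\<dots> = finprod ?A (\<lambda>X. x \<otimes> c y X \<otimes> inv x) (rcosets A) \<otimes>\<^bsub>?A\<^esub>
                     finprod ?A (\<lambda>X. c x (t y X)) (rcosets A)"
      using c t xy inv_op_closed2 by (intro A.finprod_multf) auto
    also have "finprod ?A (\<lambda>X. c x (t y X)) (rcosets A) = finprod ?A (c x) (t y ` (rcosets A))"
      using bij[OF xy(2)] c(1)[OF xy(1)] t[OF xy(2)]
      by (intro A.finprod_reindex[symmetric]) (auto simp: bij_betw_def)
    also have "t y ` (rcosets A) = rcosets A" using bij[OF xy(2)] by (simp add: bij_betw_def)
    also have "finprod ?A (\<lambda>X. x \<otimes> c y X \<otimes> inv x) (rcosets A) = x \<otimes> d y \<otimes> inv x"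
      unfolding d_def using A.finprod_hom[OF conj_hom[OF xy(1)], of "c y" "rcosets A"] c(1)[OF xy(2)] by simp
    finally show ?thesis by (simp add: d_def)
  qed
  have d_on_A: "d a = a [^] n" if a: "a \<in> A" for a
  proof -
    have "c a X = a" if X: "X \<in> rcosets A" for X
    proof -
      have "t a X = X" using a s[OF X] coset_left by (simp add: t_def)
      then show ?thesis using a s[OF X] by (simp add: c_def m_assoc)
    qed
    then have "d a = finprod ?A (\<lambda>X. a) (rcosets A)"
      unfolding d_def using a by (intro A.finprod_cong') auto
    also have "\<dots> = a [^] n" using A.finprod_const[of a "rcosets A"] a by (simp add: n_def powA)
    finally show ?thesis .
  qed
  have "finite A" using assms(2) subset by (rule finite_subset[rotated])
  then have "card A \<noteq> 0" using subgroup.one_closed[OF subgroup_axioms] by (metis card_eq_0_iff empty_iff)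
  have pow_card: "a [^] card A = \<one>" if "a \<in> A" for a
    using A.power_order_eq_one[of a] that \<open>finite A\<close> by (simp add: powA)
  have "n \<noteq> 0"
    using lagrange[OF subgroup_axioms] assms(2) order_gt_0_iff_finite by (metis n_def mult_0 less_irrefl)
  moreover have "gcd n (card A) = 1" using cop by (simp add: n_def gcd.commute)
  \<comment> \<open>Modulo \<open>card A\<close> the exponent \<open>n\<close> is inverted by
    \<open>m\<close>, so raising to \<open>m\<close> undoes raising to \<open>n\<close> on
    \<open>A\<close>.\<close>
  ultimately obtain m k where mk: "n * m = card A * k + 1" using bezout_nat[of n "card A"] by auto
  have root: "(a [^] m) [^] n = a" "(a [^] n) [^] m = a" if "a \<in> A" for a
  proof -
    have "(a [^] n) [^] m = (a [^] card A) [^] k \<otimes> a"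
      using that mk by (simp add: nat_pow_pow nat_pow_mult[symmetric] mult.commute)
    then show "(a [^] n) [^] m = a" using that pow_card by simp
    then show "(a [^] m) [^] n = a" using that by (simp add: nat_pow_pow mult.commute)
  qed
  define C where "C = {x \<in> carrier Q. d x = \<one>}"
  have d1: "d \<one> = \<one>" using d_on_A[of \<one>] by simp
  have "subgroup C Q"
  proof (rule subgroupI)
    show "C \<noteq> {}" using d1 by (auto simp: C_def)
    fix x assume x: "x \<in> C"
    then have "d (inv x \<otimes> x) = (inv x \<otimes> \<one> \<otimes> inv (inv x)) \<otimes> d (inv x)"
      by (subst dd) (auto simp: C_def)
    then show "inv x \<in> C" using x d1 dA[of "inv x"] by (simp add: C_def)
    fix y assume "y \<in> C"
    then show "x \<otimes> y \<in> C" using x by (auto simp: C_def dd)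
  qed (auto simp: C_def)
  moreover have "C \<inter> A = {\<one>}"
  proof
    show "C \<inter> A \<subseteq> {\<one>}"
    proof
      fix a assume a: "a \<in> C \<inter> A"
      then have "a [^] n = \<one>" using d_on_A[of a, symmetric] by (simp add: C_def)
      then show "a \<in> {\<one>}" using root(2)[of a] a by simp
    qed
  qed (use d1 in \<open>auto simp: C_def\<close>)
  moreover have "\<exists>a\<in>A. a \<otimes> x \<in> C" if x: "x \<in> carrier Q" for x
  proof (rule bexI)
    \<comment> \<open>Chosen so that \<open>d a = inv (d x)\<close>; as \<open>A\<close> is abelian,
      \<open>d (a \<otimes> x)\<close> then becomes trivial.\<close>
    define a where "a = (inv (d x)) [^] m"
    have dx: "inv (d x) \<in> A" using dA[OF x] by simp
    show a: "a \<in> A" using A.nat_pow_closed[of "inv (d x)" m] dx by (simp add: a_def powA)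
    have "d (a \<otimes> x) = (a \<otimes> d x \<otimes> inv a) \<otimes> d a" using a x by (intro dd) auto
    also have "a \<otimes> d x \<otimes> inv a = d x" using comm[OF a dA[OF x]] a dA[OF x] by (simp add: m_assoc)
    also have "d a = inv (d x)" using d_on_A[OF a] root(1)[OF dx] by (simp add: a_def)
    finally show "a \<otimes> x \<in> C" using a x dA[OF x] by (simp add: C_def)
  qed
  ultimately show thesis using that by blast
qed

section \<open>Minimal supplements of a normal subgroup\<close>


lemma (in group) sylow_subgroup_exists:
  assumes "subgroup M G" "finite M" "prime p"
  obtains P a m where "subgroup P G" "P \<subseteq> M" "card P = p ^ a" "card M = p ^ a * m" "\<not> p dvd m"
proof -
  interpret M: subgroup M G by fact
  have "card M \<noteq> 0" using assms(2) M.one_closed by (metis card_eq_0_iff empty_iff)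
  then obtain m where m: "card M = p ^ multiplicity p (card M) * m" "\<not> p dvd m"
    using multiplicity_decompose'[of "card M" p] assms(3) not_prime_unit by blast
  then obtain P where P: "subgroup P (G\<lparr>carrier := M\<rparr>)" "card P = p ^ multiplicity p (card M)"
    using sylow_thm[OF assms(3) M.subgroup_is_group[OF is_group], of "multiplicity p (card M)" m] assms(2)
    by (auto simp: order_def)
  then show thesis
    using m incl_subgroup[OF assms(1) P(1)] subgroup.subset[OF P(1)] by (intro that) auto
qed

text \<open>Conjugation by \<open>x\<close> sends \<open>P\<close> to another
  \<open>p\<close>-subgroup of the normal subgroup \<open>M\<close>, and Sylow conjugacy inside
  \<open>M\<close> supplies \<open>k\<close> that moves it back into \<open>P\<close>.\<close>

lemma (in group) frattini_argument:
  assumes "M \<lhd> G" "prime p" "card M = p ^ a * m" "\<not> p dvd m"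
    and P: "subgroup P G" "P \<subseteq> M" "card P = p ^ a" and x: "x \<in> carrier G"
  shows "\<exists>k\<in>M. \<forall>y\<in>P. (k \<otimes> x) \<otimes> y \<otimes> inv (k \<otimes> x) \<in> P"
proof -
  interpret M: normal M G by fact
  interpret P: subgroup P G by fact
  let ?M = "G\<lparr>carrier := M\<rparr>"
  interpret GM: group ?M by (rule M.subgroup_is_group) (rule is_group)
  define c where "c y = x \<otimes> y \<otimes> inv x" for y
  have c_hom: "group_hom G G c"
  proof (unfold_locales, rule homI)
    fix u v assume "u \<in> carrier G" "v \<in> carrier G"
    then show "c (u \<otimes> v) = c u \<otimes> c v"
      using x by (simp add: c_def m_assoc) (simp add: m_assoc[symmetric])
  qed (use x in \<open>simp add: c_def\<close>)
  have "inj_on c P"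
    using x by (auto simp: inj_on_def c_def)
  then have "card (c ` P) = p ^ a" using P(3) by (simp add: card_image)
  moreover have "c ` P \<subseteq> M" using P(2) M.inv_op_closed2[OF x] by (auto simp: c_def)
  then have "subgroup (c ` P) ?M"
    by (intro subgroup_incl group_hom.subgroup_img_is_subgroup[OF c_hom P(1)] M.subgroup_axioms)
  moreover have "subgroup P ?M" by (intro subgroup_incl P M.subgroup_axioms)
  ultimately obtain k where k: "k \<in> M" "\<And>y. y \<in> c ` P \<Longrightarrow> k \<otimes> y \<otimes> inv\<^bsub>?M\<^esub> k \<in> P"
    using sylow_conjugate[OF GM.is_group assms(2), of a m P "c ` P" a] assms(3,4) P(3)
    by (auto simp: order_def)
  have "(k \<otimes> x) \<otimes> y \<otimes> inv (k \<otimes> x) \<in> P" if "y \<in> P" for y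
    using k(2)[of "c y"] k(1) that x m_inv_consistent[OF M.subgroup_axioms k(1)]
    by (simp add: c_def inv_mult_group m_assoc)
  then show ?thesis using k(1) by blast
qed

text \<open>The equivalence, in place of a mere inclusion, gives closure under inverses for every
  set \<open>P\<close>, finite or not.\<close>

lemma (in group) subgroup_normalizer:
  assumes "P \<subseteq> carrier G"
  shows "subgroup {x \<in> carrier G. \<forall>y\<in>carrier G. y \<in> P \<longleftrightarrow> x \<otimes> y \<otimes> inv x \<in> P} G" (is "subgroup ?N G")
proof (rule subgroupI)
  have "\<one> \<in> ?N" by simp
  then show "?N \<noteq> {}" by blast
  fix x assume x: "x \<in> ?N"
  have "y \<in> P \<longleftrightarrow> inv x \<otimes> y \<otimes> x \<in> P" if y: "y \<in> carrier G" for y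
  proof -
    have "x \<otimes> (inv x \<otimes> y \<otimes> x) \<otimes> inv x = y"
      using x y by (simp add: m_assoc) (simp add: m_assoc[symmetric])
    moreover have "inv x \<otimes> y \<otimes> x \<in> P \<longleftrightarrow> x \<otimes> (inv x \<otimes> y \<otimes> x) \<otimes> inv x \<in> P" using x y by blast
    ultimately show ?thesis by simp
  qed
  moreover have xc: "x \<in> carrier G" using x by simp
  ultimately have "\<forall>y\<in>carrier G. y \<in> P \<longleftrightarrow> inv x \<otimes> y \<otimes> inv (inv x) \<in> P" by simp
  then show "inv x \<in> ?N" using xc by blast
  fix x' assume x': "x' \<in> ?N"
  have "y \<in> P \<longleftrightarrow> (x \<otimes> x') \<otimes> y \<otimes> inv (x \<otimes> x') \<in> P" if y: "y \<in> carrier G" for y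
  proof -
    have x'c: "x' \<in> carrier G" using x' by simp
    have "(x \<otimes> x') \<otimes> y \<otimes> inv (x \<otimes> x') = x \<otimes> (x' \<otimes> y \<otimes> inv x') \<otimes> inv x"
      using xc x'c y by (simp add: inv_mult_group m_assoc)
    moreover have "x' \<otimes> y \<otimes> inv x' \<in> P \<longleftrightarrow> x \<otimes> (x' \<otimes> y \<otimes> inv x') \<otimes> inv x \<in> P"
      using x x'c y by blast
    moreover have "y \<in> P \<longleftrightarrow> x' \<otimes> y \<otimes> inv x' \<in> P" using x' y by blast
    ultimately show ?thesis by simp
  qed
  then show "x \<otimes> x' \<in> ?N" using x x' by blast
qed auto

text \<open>By the Frattini argument the normalizer of \<open>P\<close> meets every coset of the
  kernel, so it maps onto \<open>H\<close>. Minimality forces it to be the whole group.\<close>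

lemma (in group_hom) minimal_sylow_normal:
  assumes fin: "finite (carrier G)" and onto: "h ` carrier G = carrier H"
    and min: "\<And>K. subgroup K G \<Longrightarrow> h ` K = carrier H \<Longrightarrow> K = carrier G"
    and "prime p" "subgroup P G" "P \<subseteq> kernel G H h" "card P = p ^ a"
    and "card (kernel G H h) = p ^ a * m" "\<not> p dvd m"
  shows "P \<lhd> G"
proof -
  interpret P: subgroup P G by fact
  define N where "N = {x \<in> carrier G. \<forall>y\<in>carrier G. y \<in> P \<longleftrightarrow> x \<otimes> y \<otimes> inv x \<in> P}"
  \<comment> \<open>As \<open>P\<close> is finite and conjugation injective, conjugating
    \<open>P\<close> into itself already normalizes it.\<close>
  have conj_iff: "x \<in> N" if x: "x \<in> carrier G" "\<forall>y\<in>P. x \<otimes> y \<otimes> inv x \<in> P" for x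
  proof -
    let ?c = "\<lambda>y. x \<otimes> y \<otimes> inv x"
    have inj: "inj_on ?c (carrier G)" using x by (auto simp: inj_on_def)
    have "finite P" using fin P.subset by (rule finite_subset[rotated])
    moreover have "inj_on ?c P" using inj P.subset by (rule inj_on_subset)
    ultimately have "?c ` P = P" using x(2) by (intro endo_inj_surj) auto
    have "y \<in> P" if y: "y \<in> carrier G" "?c y \<in> P" for y
    proof -
      have "?c y \<in> ?c ` P" using y(2) unfolding \<open>?c ` P = P\<close> .
      then obtain y' where "y' \<in> P" "?c y = ?c y'" by blast
      then show ?thesis using inj_onD[OF inj, of y y'] y(1) P.subset by blast
    qed
    then show ?thesis using x unfolding N_def by blast
  qed
  have "subgroup N G" unfolding N_def by (rule G.subgroup_normalizer) (rule P.subset)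
  moreover have "h ` N = carrier H"
  proof
    show "h ` N \<subseteq> carrier H" by (auto simp: N_def)
    show "carrier H \<subseteq> h ` N"
    proof
      fix z assume "z \<in> carrier H"
      then obtain x where x: "x \<in> carrier G" "z = h x" using onto by blast
      then obtain k where k: "k \<in> kernel G H h" "\<forall>y\<in>P. (k \<otimes> x) \<otimes> y \<otimes> inv (k \<otimes> x) \<in> P"
        using G.frattini_argument[OF normal_kernel, of p a m P x] assms(4-) by blast
      then have "k \<otimes> x \<in> N" using x by (intro conj_iff) (auto simp: kernel_def)
      moreover have "h (k \<otimes> x) = z" using k x by (simp add: kernel_def)
      ultimately show "z \<in> h ` N" by blast
    qed
  qed
  ultimately have "N = carrier G" by (rule min)
  then show ?thesis using P.subset P.subgroup_axioms by (auto simp: G.normal_inv_iff N_def)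
qed

text \<open>Otherwise the Sylow subgroup \<open>P\<close> of the kernel, which is normal by
  minimality, has index prime to \<open>p\<close>. Modulo its derived subgroup \<open>L\<close> it
  is abelian and therefore has a complement, whose preimage still maps onto \<open>H\<close>.
  Minimality then gives \<open>P = L\<close>, which is impossible for a nontrivial
  \<open>p\<close>-group.\<close>

lemma (in group_hom) minimal_prime_dvd_order:
  assumes fin: "finite (carrier G)" and onto: "h ` carrier G = carrier H"
    and min: "\<And>K. subgroup K G \<Longrightarrow> h ` K = carrier H \<Longrightarrow> K = carrier G"
    and "prime p" "p dvd card (kernel G H h)"
  shows "p dvd order H"
proof (rule ccontr)
  assume ndvd: "\<not> p dvd order H"
  let ?M = "kernel G H h"
  have M: "?M \<subseteq> carrier G" by (auto simp: kernel_def)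
  have finM: "finite ?M" using fin M by (rule finite_subset[rotated])
  obtain P a m where P: "subgroup P G" "P \<subseteq> ?M" "card P = p ^ a" "card ?M = p ^ a * m" "\<not> p dvd m"
    using G.sylow_subgroup_exists[OF subgroup_kernel finM assms(4)] by metis
  have "a > 0" using P(4,5) assms(5) by (cases a) auto
  have nP: "P \<lhd> G"
    using assms(4) P by (intro minimal_sylow_normal fin onto min) auto
  interpret P: normal P G by fact
  interpret GP: group "G\<lparr>carrier := P\<rparr>" by (rule P.subgroup_is_group) (rule G.is_group)
  define L where "L = derived G P"
  have "L \<lhd> G" unfolding L_def by (rule G.derived_is_normal) (rule nP)
  interpret L: normal L G by fact
  have "L \<noteq> P"
    using p_group_derived_proper[OF GP.is_group assms(4), of a] \<open>a > 0\<close> P(3)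
      G.derived_consistent[OF order_refl P(1)] by (simp add: order_def L_def)
  have LP: "L \<subseteq> P" unfolding L_def by (rule G.derived_incl) (use P(1) in auto)
  interpret q: group_hom G "G Mod L" "(#>) L"
    using L.r_coset_hom_Mod by (simp add: group_hom_def group_hom_axioms_def L.factorgroup_is_group)
  have q_onto: "(#>) L ` carrier G = carrier (G Mod L)" by (simp add: carrier_FactGroup)
  have q_one: "L #> x = \<one>\<^bsub>G Mod L\<^esub> \<longleftrightarrow> x \<in> L" if "x \<in> carrier G" for x
    using that L.rcos_const[OF G.is_group] G.rcos_self[OF that L.subgroup_axioms] by auto
  let ?A = "(#>) L ` P"
  have nA: "?A \<lhd> G Mod L"
    using P.surj_hom_normal_subgroup[OF q.group_hom_axioms q_onto] .
  interpret A: normal ?A "G Mod L" by fact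
  have commA: "X \<otimes>\<^bsub>G Mod L\<^esub> Y = Y \<otimes>\<^bsub>G Mod L\<^esub> X" if XY: "X \<in> ?A" "Y \<in> ?A" for X Y
  proof -
    obtain x y where xy: "x \<in> P" "y \<in> P" "X = L #> x" "Y = L #> y" using XY by blast
    then have xyc: "x \<in> carrier G" "y \<in> carrier G" by auto
    have "x \<otimes> y \<otimes> inv x \<otimes> inv y \<in> L"
      unfolding L_def derived_def using xy by (intro generate.incl) blast
    moreover have "x \<otimes> y \<otimes> inv x \<otimes> inv y = (x \<otimes> y) \<otimes> inv (y \<otimes> x)"
      using xyc by (simp add: G.inv_mult_group G.m_assoc)
    ultimately have "x \<otimes> y \<in> L #> (y \<otimes> x)" using xyc by (intro L.rcos_module_rev[OF G.is_group]) auto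
    then have "L #> (y \<otimes> x) = L #> (x \<otimes> y)"
      by (rule G.repr_independence[OF _ _ L.subgroup_axioms]) (use xyc in simp)
    then show ?thesis unfolding xy(3,4) by (simp only: mult_FactGroup L.rcos_sum xyc)
  qed
  have ordL: "order (G Mod L) * card L = order G"
    using G.lagrange[OF L.subgroup_axioms] by (simp add: order_def FactGroup_def)
  have cardL: "card L > 0" using finite_subset[OF L.subset fin] L.one_closed card_gt_0_iff by blast
  have cardA: "card ?A * card L = p ^ a"
  proof -
    interpret LP: subgroup L "G\<lparr>carrier := P\<rparr>" by (rule G.subgroup_incl) (use LP P(1) L.subgroup_axioms in auto)
    have "rcosets\<^bsub>G\<lparr>carrier := P\<rparr>\<^esub> L = ?A" by (auto simp: RCOSETS_def)
    then show ?thesis using GP.lagrange[OF LP.subgroup_axioms] P(3) by (simp add: order_def)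
  qed
  \<comment> \<open>Both sides equal \<open>order G\<close>; cancelling leaves the index
    \<open>order H * m\<close>, which is prime to \<open>p\<close>.\<close>
  have "card (rcosets\<^bsub>G Mod L\<^esub> ?A) * card ?A * card L = order H * m * (card ?A * card L)"
    using q.H.lagrange[OF A.subgroup_axioms] ordL order_eq_order_kernel[OF fin onto] P(4) cardA by simp
  then have idx: "card (rcosets\<^bsub>G Mod L\<^esub> ?A) = order H * m"
    using cardA cardL assms(4) by (auto simp: mult.assoc prime_gt_0_nat)
  obtain b where "card ?A = p ^ b" using cardA divides_primepow_nat[OF assms(4)] by (metis dvd_triv_left)
  moreover have "coprime p (order H * m)"
    using ndvd P(5) assms(4) by (simp add: prime_dvd_mult_iff prime_imp_coprime)
  ultimately have cop: "coprime (card ?A) (card (rcosets\<^bsub>G Mod L\<^esub> ?A))"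
    unfolding idx by simp
  have "finite (carrier (G Mod L))" using fin by (simp add: carrier_FactGroup)
  then obtain C where C: "subgroup C (G Mod L)" "C \<inter> ?A = {\<one>\<^bsub>G Mod L\<^esub>}"
    "\<And>X. X \<in> carrier (G Mod L) \<Longrightarrow> \<exists>Y\<in>?A. Y \<otimes>\<^bsub>G Mod L\<^esub> X \<in> C"
    using abelian_normal_coprime_complement[OF nA _ commA cop] by metis
  interpret C: subgroup C "G Mod L" by fact
  \<comment> \<open>The preimage of the complement. It maps onto \<open>H\<close> because the
    factors from \<open>P\<close> needed to reach it lie in the kernel of \<open>h\<close>.\<close>
  define K where "K = {x \<in> carrier G. L #> x \<in> C}"
  have "subgroup K G"
  proof (rule G.subgroupI)
    show "K \<noteq> {}" using C.one_closed q.hom_one by (auto simp: K_def intro!: exI[of _ \<one>])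
    fix x assume x: "x \<in> K"
    then show "inv x \<in> K" using q.hom_inv[of x] C.m_inv_closed by (auto simp: K_def)
    fix y assume y: "y \<in> K"
    then show "x \<otimes> y \<in> K" using x q.hom_mult[of x y] C.m_closed[of "L #> x" "L #> y"] by (auto simp: K_def)
  qed (auto simp: K_def)
  moreover have "h ` K = carrier H"
  proof
    show "h ` K \<subseteq> carrier H" by (auto simp: K_def)
    show "carrier H \<subseteq> h ` K"
    proof
      fix z assume "z \<in> carrier H"
      then obtain x where x: "x \<in> carrier G" "z = h x" using onto by blast
      then obtain y where y: "y \<in> P" "(L #> y) \<otimes>\<^bsub>G Mod L\<^esub> (L #> x) \<in> C"
        using C(3)[of "L #> x"] by (auto simp: carrier_FactGroup)
      then have "y \<otimes> x \<in> K" using x q.hom_mult[of y x] by (simp add: K_def)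
      moreover have "h (y \<otimes> x) = z" using P(2) x y by (auto simp: kernel_def)
      ultimately show "z \<in> h ` K" by blast
    qed
  qed
  ultimately have "K = carrier G" by (rule min)
  \<comment> \<open>Since \<open>K\<close> is the whole group, the image of \<open>P\<close> modulo
    \<open>L\<close> lies in its own complement and is trivial.\<close>
  have "P \<subseteq> L"
  proof
    fix x assume x: "x \<in> P"
    then have "x \<in> K" using \<open>K = carrier G\<close> P.subset by blast
    then have "L #> x \<in> C \<inter> ?A" using x by (auto simp: K_def)
    then have "L #> x = \<one>\<^bsub>G Mod L\<^esub>" unfolding C(2) by blast
    then show "x \<in> L" using q_one[of x] x P.subset by blast
  qed
  then show False using LP \<open>L \<noteq> P\<close> by blast
qed

section \<open>Bounds for covers of a finite group\<close>


text \<open>A subgroup of least cardinality among those mapping onto \<open>F\<close> is minimal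
  under inclusion. By Lagrange its kernel has order dividing \<open>k\<close>, so no new primes
  enter.\<close>

lemma value_cover_minimal:
  assumes "value_cover w Q F \<phi>" "order Q = order F * k"
  obtains H where "value_cover w (Q\<lparr>carrier := H\<rparr>) F \<phi>"
    "verbal_subgroup (Q\<lparr>carrier := H\<rparr>) w = verbal_subgroup Q w"
    "card (kernel (Q\<lparr>carrier := H\<rparr>) F \<phi>) dvd k"
    "\<And>K. subgroup K (Q\<lparr>carrier := H\<rparr>) \<Longrightarrow> \<phi> ` K = carrier F \<Longrightarrow> K = H"
proof -
  note cover = value_coverD[OF assms(1)]
  interpret group_hom Q F \<phi> by (rule cover)
  have "subgroup (carrier Q) Q \<and> \<phi> ` carrier Q = carrier F" using cover(3) G.subgroup_self by blast
  then obtain H where H: "subgroup H Q" "\<phi> ` H = carrier F"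
    and least: "\<And>K. subgroup K Q \<Longrightarrow> \<phi> ` K = carrier F \<Longrightarrow> card H \<le> card K"
    using ex_has_least_nat[of "\<lambda>H. subgroup H Q \<and> \<phi> ` H = carrier F" "carrier Q" card] by blast
  have HQ: "H \<subseteq> carrier Q" using H(1) by (rule subgroup.subset)
  have finH: "finite H" using cover(2) HQ by (rule finite_subset[rotated])
  note cover' = value_cover_subgroup[OF assms(1) H]
  note D = value_coverD[OF cover'(1)]
  have "card H = order F * card (kernel (Q\<lparr>carrier := H\<rparr>) F \<phi>)"
    using group_hom.order_eq_order_kernel[OF D(1-3)] by (simp add: order_def)
  moreover have "card H dvd order F * k"
    using G.lagrange[OF H(1)] unfolding assms(2) by (rule dvdI[OF trans[OF sym mult.commute]])
  moreover have "order F > 0"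
    using cover(2) unfolding H.order_gt_0_iff_finite cover(3)[symmetric] by simp
  ultimately have "card (kernel (Q\<lparr>carrier := H\<rparr>) F \<phi>) dvd k" by simp
  moreover have "K = H" if K: "subgroup K (Q\<lparr>carrier := H\<rparr>)" "\<phi> ` K = carrier F" for K
  proof -
    have "subgroup K Q" by (rule G.incl_subgroup[OF H(1) K(1)])
    then have "card H \<le> card K" using K(2) by (rule least)
    moreover have "K \<subseteq> H" using subgroup.subset[OF K(1)] by simp
    ultimately show ?thesis using finH by (metis card_seteq)
  qed
  ultimately show thesis using cover' that by metis
qed

text \<open>As \<open>P\<close> lies in the kernel, \<open>Q Mod P\<close> is again a cover of
  \<open>F\<close>, of order \<open>order F * m\<close>. Its elements are cosets, so the bound is
  applied to a copy on the naturals.\<close>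

lemma card_image_verbal_subgroup_le:
  fixes Q :: "('a, 'm) monoid_scheme"
  assumes "value_cover w Q F \<phi>" "P \<lhd> Q" "P \<subseteq> kernel Q F \<phi>" "order Q = order F * (card P * m)"
    and bound: "\<And>(Q' :: nat monoid) \<psi>. value_cover w Q' F \<psi> \<Longrightarrow> order Q' = order F * m \<Longrightarrow>
      card (verbal_subgroup Q' w) \<le> B"
  shows "card ((#>\<^bsub>Q\<^esub>) P ` verbal_subgroup Q w) \<le> B"
proof -
  note cover = value_coverD[OF assms(1)]
  interpret group_hom Q F \<phi> by (rule cover)
  interpret P: normal P Q by fact
  have fin: "finite (carrier (Q Mod P))" using cover(2) by (simp add: carrier_FactGroup)
  obtain Q' :: "nat monoid" and f where Q': "group Q'" "f \<in> iso (Q Mod P) Q'"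
    using finite_group_iso_nat[OF P.factorgroup_is_group fin] by blast
  define h where "h x = f (P #>\<^bsub>Q\<^esub> x)" for x
  have "(\<lambda>x. f (P #>\<^bsub>Q\<^esub> x)) \<in> hom Q Q'"
    using Group.hom_compose[OF P.r_coset_hom_Mod, of f Q'] Q'(2) by (simp add: iso_def comp_def)
  then have hom: "group_hom Q Q' h"
    using Q'(1) unfolding h_def[abs_def] by (simp add: group_hom_def group_hom_axioms_def)
  have f_inj: "inj_on f (carrier (Q Mod P))" and f_onto: "f ` carrier (Q Mod P) = carrier Q'"
    using Q'(2) by (auto simp: iso_def bij_betw_def)
  have onto: "h ` carrier Q = carrier Q'"
    unfolding f_onto[symmetric] by (auto simp: h_def carrier_FactGroup)
  have eq: "\<phi> x = \<phi> y" if xy: "x \<in> carrier Q" "y \<in> carrier Q" "h x = h y" for x y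
  proof -
    have "P #>\<^bsub>Q\<^esub> x = P #>\<^bsub>Q\<^esub> y"
      using xy by (intro inj_onD[OF f_inj]) (auto simp: h_def carrier_FactGroup)
    then have "x \<in> P #>\<^bsub>Q\<^esub> y" using G.rcos_self[OF xy(1) P.subgroup_axioms] by simp
    then obtain z where "z \<in> P" "x = z \<otimes>\<^bsub>Q\<^esub> y" by (auto simp: r_coset_def)
    then show ?thesis using assms(3) xy by (auto simp: kernel_def)
  qed
  have "finite (carrier Q')" using cover(2) unfolding onto[symmetric] by (rule finite_imageI)
  then obtain \<psi> where \<psi>: "value_cover w Q' F \<psi>"
    using value_cover_of_quotient[OF cover(1,3,4) hom onto _ eq] by blast
  have "order (Q Mod P) * card P = order Q"
    using G.lagrange[OF P.subgroup_axioms] by (simp add: order_def FactGroup_def)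
  moreover have "card P > 0"
    using finite_subset[OF P.subset cover(2)] P.one_closed card_gt_0_iff by blast
  ultimately have "order (Q Mod P) = order F * m" using assms(4) by auto
  then have "order Q' = order F * m" using card_image[OF f_inj] f_onto by (simp add: order_def)
  then have "card (verbal_subgroup Q' w) \<le> B" by (rule bound[OF \<psi>])
  moreover have "verbal_subgroup Q' w = f ` (#>\<^bsub>Q\<^esub>) P ` verbal_subgroup Q w"
    unfolding verbal_subgroup_image[OF hom onto] image_image h_def ..
  moreover have "(#>\<^bsub>Q\<^esub>) P ` verbal_subgroup Q w \<subseteq> carrier (Q Mod P)"
    using verbal_subgroup_subset[OF G.is_group] by (auto simp: carrier_FactGroup)
  ultimately show ?thesis by (simp add: card_image inj_on_subset[OF f_inj])
qed

lemma prime_power_if_only_prime_factor: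
  fixes k :: nat
  assumes "k > 0" "prime p" "\<And>q. prime q \<Longrightarrow> q dvd k \<Longrightarrow> q = p"
  obtains n where "k = p ^ n"
proof -
  obtain m where m: "k = p ^ multiplicity p k * m" "\<not> p dvd m"
    using multiplicity_decompose'[of k p] assms(1,2) not_prime_unit by blast
  have "m = 1"
  proof (rule ccontr)
    assume "m \<noteq> 1"
    then obtain q where "prime q" "q dvd m" using prime_factor_nat by blast
    moreover have "q dvd k" using m(1) \<open>q dvd m\<close> by (metis dvd_mult)
    ultimately show False using assms(3) m(2) by blast
  qed
  then show thesis using m(1) that by simp
qed

text \<open>Induction on the set of primes. For two different primes in \<open>S\<close>, the
  corresponding Sylow subgroups of the kernel of a minimal cover are normal and meet trivially, so
  the verbal subgroup embeds into the product of its images modulo the two. Each image is bounded by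
  the induction hypothesis.\<close>

lemma value_cover_bound_primes:
  fixes F :: "('f, 'n) monoid_scheme"
  assumes prime_bound: "\<And>p. prime p \<Longrightarrow> \<exists>B. \<forall>(Q :: nat monoid) \<phi> n.
      value_cover w Q F \<phi> \<and> order Q = order F * p ^ n \<longrightarrow> card (verbal_subgroup Q w) \<le> B"
    and "finite S" "\<forall>p\<in>S. prime p"
  shows "\<exists>B. \<forall>(Q :: nat monoid) \<phi> k. value_cover w Q F \<phi> \<and> order Q = order F * k \<and>
      (\<forall>p. prime p \<longrightarrow> p dvd k \<longrightarrow> p \<in> S) \<longrightarrow> card (verbal_subgroup Q w) \<le> B"
  using assms(2,3)
proof (induction S rule: finite_psubset_induct)
  case (psubset S)
  have k_pos: "k > 0" if "value_cover w Q F \<phi>" "order Q = order F * k" for Q :: "nat monoid" and \<phi> k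
  proof -
    interpret group_hom Q F \<phi> using that(1) by (rule value_coverD)
    have "order Q > 0" using value_coverD(2)[OF that(1)] G.order_gt_0_iff_finite by simp
    then show ?thesis using that(2) by (cases k) auto
  qed
  show ?case
  \<comment> \<open>The first case includes the empty set, where \<open>k = 1\<close> is a power of
    any prime.\<close>
  proof (cases "\<exists>p. prime p \<and> S \<subseteq> {p}")
    case True
    then obtain p where p: "prime p" "S \<subseteq> {p}" by blast
    obtain B where B: "\<And>(Q :: nat monoid) \<phi> n. value_cover w Q F \<phi> \<Longrightarrow> order Q = order F * p ^ n \<Longrightarrow>
        card (verbal_subgroup Q w) \<le> B"
      using prime_bound[OF p(1)] by blast
    have "card (verbal_subgroup Q w) \<le> B"
      if Q: "value_cover w Q F \<phi>" "order Q = order F * k" "\<forall>p. prime p \<longrightarrow> p dvd k \<longrightarrow> p \<in> S"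
      for Q :: "nat monoid" and \<phi> k
    proof -
      obtain n where "k = p ^ n"
        using prime_power_if_only_prime_factor[OF k_pos[OF Q(1,2)] p(1)] Q(3) p(2) by blast
      then show ?thesis using B Q by blast
    qed
    then show ?thesis by blast
  next
    case False
    \<comment> \<open>The failure of \<open>S \<subseteq> {2}\<close> shows that \<open>S\<close> is
      nonempty.\<close>
    then obtain p where p: "p \<in> S" using two_is_prime_nat by blast
    moreover have "prime p" using p psubset.prems by blast
    ultimately obtain q where q: "q \<in> S" "q \<noteq> p" using False by blast
    have "\<exists>B. \<forall>(Q :: nat monoid) \<phi> k. value_cover w Q F \<phi> \<and> order Q = order F * k \<and>
        (\<forall>p. prime p \<longrightarrow> p dvd k \<longrightarrow> p \<in> S - {r}) \<longrightarrow> card (verbal_subgroup Q w) \<le> B"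
      if "r \<in> S" for r
      using that psubset.prems by (intro psubset.IH) auto
    then obtain B where B: "\<And>r (Q :: nat monoid) \<phi> k. r \<in> S \<Longrightarrow> value_cover w Q F \<phi> \<Longrightarrow>
        order Q = order F * k \<Longrightarrow> \<forall>p. prime p \<longrightarrow> p dvd k \<longrightarrow> p \<in> S - {r} \<Longrightarrow>
        card (verbal_subgroup Q w) \<le> B r"
      by metis
    have "card (verbal_subgroup Q w) \<le> B p * B q"
      if Q: "value_cover w Q F \<phi>" "order Q = order F * k" "\<forall>p. prime p \<longrightarrow> p dvd k \<longrightarrow> p \<in> S"
      for Q :: "nat monoid" and \<phi> k
    proof -
      obtain H where H: "value_cover w (Q\<lparr>carrier := H\<rparr>) F \<phi>"
        "verbal_subgroup (Q\<lparr>carrier := H\<rparr>) w = verbal_subgroup Q w"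
        "card (kernel (Q\<lparr>carrier := H\<rparr>) F \<phi>) dvd k"
        "\<And>K. subgroup K (Q\<lparr>carrier := H\<rparr>) \<Longrightarrow> \<phi> ` K = carrier F \<Longrightarrow> K = H"
        by (rule value_cover_minimal[OF Q(1,2)]) blast
      define R where "R = Q\<lparr>carrier := H\<rparr>"
      define M where "M = kernel R F \<phi>"
      note cover = value_coverD[OF H(1), folded R_def]
      interpret group_hom R F \<phi> by (rule cover)
      have min: "K = carrier R" if "subgroup K R" "\<phi> ` K = carrier F" for K
        using H(4) that by (simp add: R_def)
      have finM: "finite M" using cover(2) by (auto simp: M_def kernel_def)
      have ord: "order R = order F * card M"
        unfolding M_def by (rule order_eq_order_kernel[OF cover(2,3)])
      \<comment> \<open>Dividing out the Sylow \<open>r\<close>-subgroup leaves a cover of order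
        \<open>order F * m\<close> with \<open>m\<close> prime to \<open>r\<close>, so the bound for
        \<open>S - {r}\<close> applies.\<close>
      have ex: "\<exists>P a. P \<lhd> R \<and> card P = r ^ a \<and> card ((#>\<^bsub>R\<^esub>) P ` verbal_subgroup R w) \<le> B r"
        if r: "r \<in> S" for r
      proof -
        have "prime r" using r psubset.prems by blast
        obtain P a m where P: "subgroup P R" "P \<subseteq> M" "card P = r ^ a" "card M = r ^ a * m" "\<not> r dvd m"
          using G.sylow_subgroup_exists[OF subgroup_kernel finM[unfolded M_def] \<open>prime r\<close>, folded M_def]
          by metis
        have nP: "P \<lhd> R"
          using P \<open>prime r\<close> unfolding M_def by (intro minimal_sylow_normal[OF cover(2,3) min]) auto
        have "m dvd k" using P(4) H(3) by (metis M_def R_def dvd_mult_right)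
        then have "\<forall>p. prime p \<longrightarrow> p dvd m \<longrightarrow> p \<in> S - {r}"
          using Q(3) P(5) by (metis Diff_iff dvd_trans singletonD)
        then have "card (verbal_subgroup Q' w) \<le> B r"
          if "value_cover w Q' F \<psi>" "order Q' = order F * m" for Q' :: "nat monoid" and \<psi>
          using B[OF r that] by blast
        then have "card ((#>\<^bsub>R\<^esub>) P ` verbal_subgroup R w) \<le> B r"
          using card_image_verbal_subgroup_le[OF H(1)[folded R_def] nP P(2)[unfolded M_def], of m]
            ord P(3,4) by simp
        then show ?thesis using nP P(3) by blast
      qed
      obtain P a where P: "P \<lhd> R" "card P = p ^ a" "card ((#>\<^bsub>R\<^esub>) P ` verbal_subgroup R w) \<le> B p"
        using ex[OF p] by blast
      obtain P' b where P': "P' \<lhd> R" "card P' = q ^ b" "card ((#>\<^bsub>R\<^esub>) P' ` verbal_subgroup R w) \<le> B q"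
        using ex[OF q(1)] by blast
      interpret P: normal P R by (rule P)
      interpret P': normal P' R by (rule P')
      have primes: "prime p" "prime q" using p q psubset.prems by blast+
      \<comment> \<open>The order of the intersection divides powers of two different
        primes.\<close>
      have int: "P \<inter> P' = {\<one>\<^bsub>R\<^esub>}"
      proof -
        have sub: "subgroup (P \<inter> P') R" by (intro subgroup_Int P.subgroup_axioms P'.subgroup_axioms)
        have dvd: "card (P \<inter> P') dvd card K" if K: "subgroup K R" "P \<inter> P' \<subseteq> K" for K
        proof -
          interpret GK: group "R\<lparr>carrier := K\<rparr>" using K(1) G.is_group by (rule subgroup.subgroup_is_group)
          have "subgroup (P \<inter> P') (R\<lparr>carrier := K\<rparr>)" by (rule G.subgroup_incl[OF sub K])
          then have "card (rcosets\<^bsub>R\<lparr>carrier := K\<rparr>\<^esub> (P \<inter> P')) * card (P \<inter> P') = card K"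
            using GK.lagrange by (simp add: order_def)
          then show ?thesis by (rule dvdI[OF trans[OF sym mult.commute]])
        qed
        have "card (P \<inter> P') dvd p ^ a" "card (P \<inter> P') dvd q ^ b"
          using dvd[OF P.subgroup_axioms] dvd[OF P'.subgroup_axioms] P(2) P'(2) by auto
        moreover have "coprime (p ^ a) (q ^ b)" using primes q(2) by (simp add: primes_coprime)
        ultimately have "card (P \<inter> P') = 1" by (metis coprime_common_divisor_nat)
        then show ?thesis using subgroup.one_closed[OF sub] by (metis card_1_singletonE singletonD)
      qed
      let ?V = "verbal_subgroup R w"
      have V: "?V \<subseteq> carrier R" by (rule verbal_subgroup_subset) (rule G.is_group)
      have "inj_on (\<lambda>x. (P #>\<^bsub>R\<^esub> x, P' #>\<^bsub>R\<^esub> x)) ?V"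
      proof (rule inj_onI)
        fix x y assume "x \<in> ?V" "y \<in> ?V" and eq: "(P #>\<^bsub>R\<^esub> x, P' #>\<^bsub>R\<^esub> x) = (P #>\<^bsub>R\<^esub> y, P' #>\<^bsub>R\<^esub> y)"
        then have xy: "x \<in> carrier R" "y \<in> carrier R" using V by blast+
        have "x \<in> P #>\<^bsub>R\<^esub> y" "x \<in> P' #>\<^bsub>R\<^esub> y"
          using G.rcos_self[OF xy(1) P.subgroup_axioms] G.rcos_self[OF xy(1) P'.subgroup_axioms] eq by auto
        then have "x \<otimes>\<^bsub>R\<^esub> inv\<^bsub>R\<^esub> y \<in> P \<inter> P'"
          using P.rcos_module_imp[OF G.is_group xy(2)] P'.rcos_module_imp[OF G.is_group xy(2)] by blast
        then have "x \<otimes>\<^bsub>R\<^esub> inv\<^bsub>R\<^esub> y = \<one>\<^bsub>R\<^esub>" using int by blast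
        then show "x = y" using xy G.inv_solve_right'[of x "\<one>\<^bsub>R\<^esub>" y] G.r_inv G.inv_equality
          by (metis G.inv_closed G.inv_inv)
      qed
      then have "card ?V = card ((\<lambda>x. (P #>\<^bsub>R\<^esub> x, P' #>\<^bsub>R\<^esub> x)) ` ?V)" by (simp add: card_image)
      also have "\<dots> \<le> card (((#>\<^bsub>R\<^esub>) P ` ?V) \<times> ((#>\<^bsub>R\<^esub>) P' ` ?V))"
        using finite_subset[OF V cover(2)] by (intro card_mono) auto
      also have "\<dots> \<le> B p * B q" using P(3) P'(3) by (simp add: card_cartesian_product mult_le_mono)
      finally show ?thesis using H(2) by (simp add: R_def)
    qed
    then show ?thesis by blast
  qed
qed

text \<open>A minimal cover inside \<open>Q\<close> has the same verbal subgroup, and the primes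
  dividing its kernel divide \<open>order F\<close>. They form a finite set depending on
  \<open>F\<close> alone, so one bound serves all covers.\<close>

theorem value_cover_bound:
  fixes F :: "('f, 'n) monoid_scheme"
  assumes prime_bound: "\<And>p. prime p \<Longrightarrow> \<exists>B. \<forall>(Q :: nat monoid) \<phi> n.
      value_cover w Q F \<phi> \<and> order Q = order F * p ^ n \<longrightarrow> card (verbal_subgroup Q w) \<le> B"
    and "group F" "finite (carrier F)"
  shows "\<exists>B. \<forall>(Q :: nat monoid) \<phi>. value_cover w Q F \<phi> \<longrightarrow> card (verbal_subgroup Q w) \<le> B"
proof -
  have "order F > 0" using assms(2,3) by (simp add: group.is_monoid monoid.order_gt_0_iff_finite)
  define S where "S = {p. prime p \<and> p dvd order F}"
  have "finite S"
    by (rule finite_subset[of _ "{..order F}"]) (use \<open>order F > 0\<close> dvd_imp_le in \<open>auto simp: S_def\<close>)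
  moreover have "\<forall>p\<in>S. prime p" by (simp add: S_def)
  ultimately obtain B where B: "\<And>(Q :: nat monoid) \<phi> k. value_cover w Q F \<phi> \<Longrightarrow> order Q = order F * k \<Longrightarrow>
      \<forall>p. prime p \<longrightarrow> p dvd k \<longrightarrow> p \<in> S \<Longrightarrow> card (verbal_subgroup Q w) \<le> B"
    using value_cover_bound_primes[OF prime_bound] by metis
  have "card (verbal_subgroup Q w) \<le> B" if Q: "value_cover w Q F \<phi>" for Q :: "nat monoid" and \<phi>
  proof -
    note ord = group_hom.order_eq_order_kernel[OF value_coverD(1-3)[OF Q]]
    obtain H where H: "value_cover w (Q\<lparr>carrier := H\<rparr>) F \<phi>"
      "verbal_subgroup (Q\<lparr>carrier := H\<rparr>) w = verbal_subgroup Q w"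
      "\<And>K. subgroup K (Q\<lparr>carrier := H\<rparr>) \<Longrightarrow> \<phi> ` K = carrier F \<Longrightarrow> K = H"
      by (rule value_cover_minimal[OF Q ord]) blast
    note cover = value_coverD[OF H(1)]
    interpret group_hom "Q\<lparr>carrier := H\<rparr>" F \<phi> by (rule cover)
    have "p \<in> S" if "prime p" "p dvd card (kernel (Q\<lparr>carrier := H\<rparr>) F \<phi>)" for p
      using minimal_prime_dvd_order[OF cover(2,3) _ that] H(3) that by (simp add: S_def)
    then show ?thesis using B[OF H(1) order_eq_order_kernel[OF cover(2,3)]] H(2) by simp
  qed
  then show ?thesis by blast
qed

section \<open>Profinite groups\<close>


text \<open>A value is determined by the images under \<open>\<psi>\<close> of the finitely many
  variables that occur in \<open>w\<close>.\<close>

lemma finite_word_values_if_factor: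
  assumes "group G" "finite (\<psi> ` carrier G)"
    and eq: "\<And>g g'. (\<And>i. g i \<in> carrier G) \<Longrightarrow> (\<And>i. g' i \<in> carrier G) \<Longrightarrow>
      (\<And>i. \<psi> (g i) = \<psi> (g' i)) \<Longrightarrow> word_eval G g w = word_eval G g' w"
  shows "finite (word_values G w)"
proof -
  interpret group G by fact
  define V where "V = fst ` set w"
  \<comment> \<open>The hypothesis \<open>eq\<close> compares assignments at every index, so both
    are set to the identity outside \<open>V\<close>.\<close>
  define lift where "lift c i = (if i \<in> V then inv_into (carrier G) \<psi> (c i) else \<one>\<^bsub>G\<^esub>)" for c i
  have "word_values G w \<subseteq> (\<lambda>c. word_eval G (lift c) w) ` (V \<rightarrow>\<^sub>E \<psi> ` carrier G)"
  proof
    fix y assume "y \<in> word_values G w"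
    then obtain g where g: "y = word_eval G g w" "\<And>i. g i \<in> carrier G" by (auto simp: word_values_def)
    define g' where "g' i = (if i \<in> V then g i else \<one>\<^bsub>G\<^esub>)" for i
    define c where "c = restrict (\<lambda>i. \<psi> (g i)) V"
    have c: "c i = \<psi> (g i)" if "i \<in> V" for i using that by (simp add: c_def)
    have "y = word_eval G g' w"
      unfolding g(1) by (rule word_eval_cong) (simp add: g'_def V_def)
    also have "\<dots> = word_eval G (lift c) w"
    proof (rule eq)
      fix i
      show "g' i \<in> carrier G" using g(2) by (simp add: g'_def)
      show "lift c i \<in> carrier G" using g(2) by (simp add: lift_def c inv_into_into)
      show "\<psi> (g' i) = \<psi> (lift c i)" using g(2) by (simp add: lift_def c g'_def f_inv_into_f)
    qed
    finally show "y \<in> (\<lambda>c. word_eval G (lift c) w) ` (V \<rightarrow>\<^sub>E \<psi> ` carrier G)"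
      using g(2) by (intro image_eqI[of _ _ c]) (auto simp: c_def)
  qed
  moreover have "finite (V \<rightarrow>\<^sub>E \<psi> ` carrier G)"
    using assms(2) by (intro finite_PiE) (auto simp: V_def)
  ultimately show ?thesis by (meson finite_imageI finite_subset)
qed

text \<open>Any invariant \<open>c\<close> with finitely many values that tells cosets apart bounds
  the index; it serves for cores, intersections and preimages.\<close>

lemma (in group) finite_rcosetsI:
  assumes "subgroup N G" "finite (c ` carrier G)"
    and "\<And>x y. x \<in> carrier G \<Longrightarrow> y \<in> carrier G \<Longrightarrow> c x = c y \<Longrightarrow> x \<otimes> inv y \<in> N"
  shows "finite (rcosets N)"
proof -
  interpret N: subgroup N G by fact
  have "rcosets N \<subseteq> (\<lambda>v. N #> inv_into (carrier G) c v) ` c ` carrier G"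
  proof
    fix X assume "X \<in> rcosets N"
    then obtain x where x: "x \<in> carrier G" "X = N #> x" by (auto simp: RCOSETS_def)
    let ?y = "inv_into (carrier G) c (c x)"
    have y: "?y \<in> carrier G" "c x = c ?y" using x(1) by (auto simp: inv_into_into f_inv_into_f)
    then have "x \<in> N #> ?y" using assms(3)[OF x(1) y] x(1) by (intro N.rcos_module_rev[OF is_group])
    then have "N #> ?y = X" unfolding x(2) by (rule repr_independence[OF _ y(1) assms(1)])
    then show "X \<in> (\<lambda>v. N #> inv_into (carrier G) c v) ` c ` carrier G" using x(1) by blast
  qed
  then show ?thesis using assms(2) by (meson finite_imageI finite_subset)
qed

lemma (in group) rcosets_eqD:
  assumes "subgroup N G" "x \<in> carrier G" "y \<in> carrier G" "N #> x = N #> y"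
  shows "x \<otimes> inv y \<in> N"
  using assms rcos_self[OF assms(2,1)] subgroup.rcos_module_imp[OF assms(1) is_group assms(3)] by simp

text \<open>If a prime \<open>q\<close> other than \<open>p\<close> divided the index, Cauchy's
  theorem (Sylow with exponent 1) would give a nontrivial coset killed by \<open>q\<close>. It is
  also killed by a power of \<open>p\<close>, hence trivial by Bezout.\<close>

lemma (in group) prime_power_index:
  assumes "N \<lhd> G" "finite (rcosets N)" "prime p"
    and pow: "\<And>x. x \<in> carrier G \<Longrightarrow> \<exists>s::nat. x [^] (p ^ s) \<in> N"
  shows "\<exists>n. card (rcosets N) = p ^ n"
proof -
  interpret N: normal N G by fact
  interpret Q: group "G Mod N" by (rule N.factorgroup_is_group)
  have car: "carrier (G Mod N) = rcosets N" by (simp add: FactGroup_def)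
  have ord: "order (G Mod N) > 0" using assms(2) by (simp add: Q.order_gt_0_iff_finite car)
  have "q = p" if q: "prime q" "q dvd order (G Mod N)" for q
  proof (rule ccontr)
    assume "q \<noteq> p"
    obtain m where "order (G Mod N) = q ^ 1 * m" using q(2) by (auto elim: dvdE)
    then obtain K where K: "subgroup K (G Mod N)" "card K = q"
      using sylow_thm[OF q(1) Q.is_group, of 1 m] assms(2) by (auto simp: car)
    interpret K: subgroup K "G Mod N" by fact
    interpret GK: group "(G Mod N)\<lparr>carrier := K\<rparr>" by (rule K.subgroup_is_group) (rule Q.is_group)
    have "K \<noteq> {\<one>\<^bsub>G Mod N\<^esub>}" using K(2) q(1) by (metis card.empty card.insert empty_iff finite.emptyI not_prime_1 One_nat_def)
    then obtain X where X: "X \<in> K" "X \<noteq> \<one>\<^bsub>G Mod N\<^esub>" using K.one_closed by blast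
    have XQ: "X \<in> carrier (G Mod N)" using X(1) by (rule K.mem_carrier)
    have "X [^]\<^bsub>(G Mod N)\<lparr>carrier := K\<rparr>\<^esub> q = \<one>\<^bsub>G Mod N\<^esub>"
      using GK.pow_order_eq_1[of X] X(1) K(2) by (simp add: order_def)
    then have Xq: "X [^]\<^bsub>G Mod N\<^esub> q = \<one>\<^bsub>G Mod N\<^esub>" by (simp add: Q.nat_pow_consistent[of X q K])
    obtain x where x: "x \<in> carrier G" "X = N #> x" using XQ by (auto simp: carrier_FactGroup)
    obtain s where "x [^] (p ^ s) \<in> N" using pow[OF x(1)] by blast
    then have Xp: "X [^]\<^bsub>G Mod N\<^esub> (p ^ s) = \<one>\<^bsub>G Mod N\<^esub>"
      using x N.FactGroup_pow[OF x(1), of "p ^ s"] N.rcos_const[OF is_group] by simp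
    have "coprime q (p ^ s)" using q(1) assms(3) \<open>q \<noteq> p\<close> by (simp add: primes_coprime)
    then obtain u v where "q * u = p ^ s * v + 1"
      using bezout_nat[of q "p ^ s"] prime_gt_0_nat[OF q(1)] by (auto simp: coprime_iff_gcd_eq_1)
    then have "X [^]\<^bsub>G Mod N\<^esub> (q * u) = X [^]\<^bsub>G Mod N\<^esub> (p ^ s * v) \<otimes>\<^bsub>G Mod N\<^esub> X"
      by simp
    then show False using XQ X(2) Xp Xq by (simp add: Q.nat_pow_pow[symmetric] del: mult_FactGroup one_FactGroup)
  qed
  then obtain n where "order (G Mod N) = p ^ n"
    using prime_power_if_only_prime_factor[OF ord assms(3)] by blast
  then show ?thesis by (auto simp: order_def car)
qed

section \<open>Residual finiteness of profinite groups\<close>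

lemma topological_group_openin_rcoset:
  assumes "topological_group G T" "openin T U" "a \<in> carrier G"
  shows "openin T (U #>\<^bsub>G\<^esub> a)"
proof -
  interpret group G using assms(1) by (simp add: topological_group_def)
  have top: "topspace T = carrier G" using assms(1) by (simp add: topological_group_def)
  have U: "U \<subseteq> carrier G" using openin_subset[OF assms(2)] top by simp
  have mult: "continuous_map (prod_topology T T) T (\<lambda>(x, y). x \<otimes>\<^bsub>G\<^esub> y)"
    using assms(1) by (simp add: topological_group_def)
  have "continuous_map T (prod_topology T T) (\<lambda>x. (x, inv\<^bsub>G\<^esub> a))"
    using assms(3) top by (auto intro!: continuous_map_pairedI simp: continuous_map_const)
  from continuous_map_compose[OF this mult]
  have "continuous_map T T (\<lambda>x. x \<otimes>\<^bsub>G\<^esub> inv\<^bsub>G\<^esub> a)" by (simp add: comp_def)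
  then have "openin T {x \<in> topspace T. x \<otimes>\<^bsub>G\<^esub> inv\<^bsub>G\<^esub> a \<in> U}"
    using assms(2) by (rule openin_continuous_map_preimage)
  also have "{x \<in> topspace T. x \<otimes>\<^bsub>G\<^esub> inv\<^bsub>G\<^esub> a \<in> U} = U #>\<^bsub>G\<^esub> a"
  proof (intro equalityI subsetI)
    fix x assume x: "x \<in> {x \<in> topspace T. x \<otimes>\<^bsub>G\<^esub> inv\<^bsub>G\<^esub> a \<in> U}"
    then have "x = (x \<otimes>\<^bsub>G\<^esub> inv\<^bsub>G\<^esub> a) \<otimes>\<^bsub>G\<^esub> a" using assms(3) top by (simp add: m_assoc)
    then show "x \<in> U #>\<^bsub>G\<^esub> a" using x unfolding r_coset_def by blast
  next
    fix x assume "x \<in> U #>\<^bsub>G\<^esub> a"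
    then obtain u where "u \<in> U" "x = u \<otimes>\<^bsub>G\<^esub> a" by (auto simp: r_coset_def)
    then show "x \<in> {x \<in> topspace T. x \<otimes>\<^bsub>G\<^esub> inv\<^bsub>G\<^esub> a \<in> U}"
      using U assms(3) top by (auto simp: m_assoc)
  qed
  finally show ?thesis .
qed

text \<open>The cosets are an open cover; being nonempty and pairwise disjoint, they must all occur
  in any finite subcover.\<close>

lemma open_subgroup_finite_index:
  assumes "topological_group G T" "compact_space T" "subgroup N G" "openin T N"
  shows "finite (rcosets\<^bsub>G\<^esub> N)"
proof -
  interpret group G using assms(1) by (simp add: topological_group_def)
  interpret N: subgroup N G by fact
  have top: "topspace T = carrier G" using assms(1) by (simp add: topological_group_def)
  have "\<forall>U\<in>rcosets\<^bsub>G\<^esub> N. openin T U"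
    using topological_group_openin_rcoset[OF assms(1,4)] by (auto simp: RCOSETS_def)
  moreover have "topspace T \<subseteq> \<Union> (rcosets\<^bsub>G\<^esub> N)" using rcosets_part_G[OF assms(3)] top by simp
  ultimately obtain \<F> where \<F>: "finite \<F>" "\<F> \<subseteq> rcosets\<^bsub>G\<^esub> N" "topspace T \<subseteq> \<Union>\<F>"
    using assms(2) unfolding compact_space_alt by metis
  have "rcosets\<^bsub>G\<^esub> N \<subseteq> \<F>"
  proof
    fix X assume X: "X \<in> rcosets\<^bsub>G\<^esub> N"
    then obtain x where x: "x \<in> carrier G" "X = N #>\<^bsub>G\<^esub> x" by (auto simp: RCOSETS_def)
    then obtain Y where Y: "Y \<in> \<F>" "x \<in> Y" using \<F>(3) top by blast
    have "x \<in> X" using x rcos_self[OF x(1) assms(3)] by simp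
    then have "X = Y" using rcos_disjoint[OF assms(3)] X Y \<F>(2) by (auto simp: pairwise_def disjnt_def)
    then show "X \<in> \<F>" using Y by simp
  qed
  then show ?thesis using \<F>(1) by (rule finite_subset)
qed

text \<open>\<open>H\<close> is the stabilizer of \<open>V\<close> under right translation. It is
  open because its complement is the projection of a closed set along a compact factor, and it lies
  in \<open>V\<close> because the identity does.\<close>

lemma clopen_neighbourhood_contains_open_subgroup:
  assumes "topological_group G T" "compact_space T" "openin T V" "closedin T V" "\<one>\<^bsub>G\<^esub> \<in> V"
  obtains H where "subgroup H G" "openin T H" "H \<subseteq> V"
proof -
  interpret group G using assms(1) by (simp add: topological_group_def)
  have top: "topspace T = carrier G" using assms(1) by (simp add: topological_group_def)
  have VG: "V \<subseteq> carrier G" using openin_subset[OF assms(3)] top by simp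
  define H where "H = {h \<in> carrier G. \<forall>v\<in>carrier G. v \<in> V \<longleftrightarrow> v \<otimes>\<^bsub>G\<^esub> h \<in> V}"
  let ?TT = "prod_topology T T"
  define A where "A = {z \<in> topspace ?TT. fst z \<in> V}"
  define B where "B = {z \<in> topspace ?TT. (case z of (x, y) \<Rightarrow> x \<otimes>\<^bsub>G\<^esub> y) \<in> V}"
  have mult: "continuous_map ?TT T (\<lambda>(x, y). x \<otimes>\<^bsub>G\<^esub> y)"
    using assms(1) by (simp add: topological_group_def)
  have "openin ?TT A" "closedin ?TT A"
    unfolding A_def
    by (rule openin_continuous_map_preimage[OF continuous_map_fst assms(3)],
        rule closedin_continuous_map_preimage[OF continuous_map_fst assms(4)])
  moreover have "openin ?TT B" "closedin ?TT B"
    unfolding B_def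
    by (rule openin_continuous_map_preimage[OF mult assms(3)],
        rule closedin_continuous_map_preimage[OF mult assms(4)])
  \<comment> \<open>The pairs \<open>(v, h)\<close> for which exactly one of \<open>v\<close> and
    \<open>v \<otimes> h\<close> is in \<open>V\<close>.\<close>
  ultimately have "closedin ?TT ((A - B) \<union> (B - A))" by (intro closedin_Un closedin_diff)
  then have "closedin T (snd ` ((A - B) \<union> (B - A)))"
    using closed_map_snd[OF assms(2), of T] by (simp add: closed_map_def)
  then have "openin T (topspace T - snd ` ((A - B) \<union> (B - A)))" by (simp add: openin_diff)
  also have "topspace T - snd ` ((A - B) \<union> (B - A)) = H"
    unfolding H_def A_def B_def top by (force simp: top image_iff)
  finally have "openin T H" .
  moreover have "subgroup H G"
  proof (rule subgroupI)
    have "\<one>\<^bsub>G\<^esub> \<in> H" by (simp add: H_def)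
    then show "H \<noteq> {}" by blast
    fix x assume x: "x \<in> H"
    then have xc: "x \<in> carrier G" by (simp add: H_def)
    have "v \<in> V \<longleftrightarrow> v \<otimes>\<^bsub>G\<^esub> inv\<^bsub>G\<^esub> x \<in> V" if v: "v \<in> carrier G" for v
    proof -
      have "v \<otimes>\<^bsub>G\<^esub> inv\<^bsub>G\<^esub> x \<in> carrier G" using v xc by simp
      then have "v \<otimes>\<^bsub>G\<^esub> inv\<^bsub>G\<^esub> x \<in> V \<longleftrightarrow> v \<otimes>\<^bsub>G\<^esub> inv\<^bsub>G\<^esub> x \<otimes>\<^bsub>G\<^esub> x \<in> V" using x unfolding H_def by blast
      then show ?thesis using v xc by (simp add: m_assoc)
    qed
    then show "inv\<^bsub>G\<^esub> x \<in> H" using xc unfolding H_def by blast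
    fix y assume y: "y \<in> H"
    then have yc: "y \<in> carrier G" by (simp add: H_def)
    have "v \<in> V \<longleftrightarrow> v \<otimes>\<^bsub>G\<^esub> (x \<otimes>\<^bsub>G\<^esub> y) \<in> V" if v: "v \<in> carrier G" for v
    proof -
      have "v \<otimes>\<^bsub>G\<^esub> x \<in> carrier G" using v xc by simp
      then have "v \<otimes>\<^bsub>G\<^esub> x \<in> V \<longleftrightarrow> v \<otimes>\<^bsub>G\<^esub> x \<otimes>\<^bsub>G\<^esub> y \<in> V" using y unfolding H_def by blast
      moreover have "v \<in> V \<longleftrightarrow> v \<otimes>\<^bsub>G\<^esub> x \<in> V" using x v unfolding H_def by blast
      ultimately show ?thesis using v xc yc by (simp add: m_assoc)
    qed
    then show "x \<otimes>\<^bsub>G\<^esub> y \<in> H" using xc yc unfolding H_def by blast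
  qed (auto simp: H_def)
  moreover have "H \<subseteq> V"
  proof
    fix h assume h: "h \<in> H"
    then have "\<one>\<^bsub>G\<^esub> \<otimes>\<^bsub>G\<^esub> h \<in> V" using assms(5) unfolding H_def by blast
    then show "h \<in> V" using h by (simp add: H_def)
  qed
  ultimately show thesis using that by blast
qed

text \<open>The intersection of all conjugates of \<open>H\<close> is the kernel of the action on
  its cosets, so it has finite index.\<close>

lemma (in group) finite_index_normal_core:
  assumes "subgroup H G" "finite (rcosets H)"
  obtains N where "N \<lhd> G" "finite (rcosets N)" "N \<subseteq> H"
proof -
  interpret H: subgroup H G by fact
  define N where "N = {y \<in> carrier G. \<forall>g\<in>carrier G. g \<otimes> y \<otimes> inv g \<in> H}"
  have N: "N \<lhd> G"
    unfolding normal_inv_iff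
  proof (intro conjI ballI subgroupI)
    show "N \<noteq> {}" by (auto simp: N_def intro!: exI[of _ \<one>])
    fix x assume x: "x \<in> N"
    then have xc: "x \<in> carrier G" by (simp add: N_def)
    have "g \<otimes> inv x \<otimes> inv g \<in> H" if g: "g \<in> carrier G" for g
    proof -
      have "inv (g \<otimes> x \<otimes> inv g) \<in> H" using x g unfolding N_def by blast
      then show ?thesis using g xc by (simp add: inv_mult_group m_assoc)
    qed
    then show "inv x \<in> N" using xc by (simp add: N_def)
    fix y assume y: "y \<in> N"
    then have yc: "y \<in> carrier G" by (simp add: N_def)
    have "g \<otimes> (x \<otimes> y) \<otimes> inv g \<in> H" if g: "g \<in> carrier G" for g
    proof -
      have "(g \<otimes> x \<otimes> inv g) \<otimes> (g \<otimes> y \<otimes> inv g) \<in> H" using x y g unfolding N_def by blast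
      also have "(g \<otimes> x \<otimes> inv g) \<otimes> (g \<otimes> y \<otimes> inv g) = g \<otimes> (x \<otimes> y) \<otimes> inv g"
        using g xc yc by (simp add: m_assoc) (simp add: m_assoc[symmetric])
      finally show ?thesis .
    qed
    then show "x \<otimes> y \<in> N" using xc yc by (simp add: N_def)
  next
    fix x h assume x: "x \<in> carrier G" and h: "h \<in> N"
    then have hc: "h \<in> carrier G" by (simp add: N_def)
    have "g \<otimes> (x \<otimes> h \<otimes> inv x) \<otimes> inv g \<in> H" if g: "g \<in> carrier G" for g
    proof -
      have "(g \<otimes> x) \<otimes> h \<otimes> inv (g \<otimes> x) \<in> H" using g x h unfolding N_def by blast
      then show ?thesis using g x hc by (simp add: inv_mult_group m_assoc)
    qed
    then show "x \<otimes> h \<otimes> inv x \<in> N" using x hc by (simp add: N_def)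
  qed (auto simp: N_def)
  have "finite (rcosets N)"
  proof (rule finite_rcosetsI)
    show "subgroup N G" using N by (rule normal_imp_subgroup)
    \<comment> \<open>The map of the finitely many cosets induced by \<open>y\<close>; elements
      inducing the same map differ by an element of \<open>N\<close>.\<close>
    let ?c = "\<lambda>y. \<lambda>C\<in>rcosets H. C #> y"
    have "?c ` carrier G \<subseteq> rcosets H \<rightarrow>\<^sub>E rcosets H"
    proof
      fix f assume "f \<in> ?c ` carrier G"
      then obtain y where y: "y \<in> carrier G" "f = ?c y" by blast
      have "C #> y \<in> rcosets H" if "C \<in> rcosets H" for C
        using that y(1) by (auto simp: RCOSETS_def coset_mult_assoc H.subset)
      then show "f \<in> rcosets H \<rightarrow>\<^sub>E rcosets H" unfolding y(2) by auto
    qed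
    then show "finite (?c ` carrier G)" using assms(2) by (meson finite_PiE finite_subset)
    fix x y assume xy: "x \<in> carrier G" "y \<in> carrier G" "?c x = ?c y"
    have "g \<otimes> (x \<otimes> inv y) \<otimes> inv g \<in> H" if g: "g \<in> carrier G" for g
    proof -
      have "H #> g \<in> rcosets H" using g by (intro rcosetsI H.subset)
      then have "H #> g #> x = H #> g #> y" using fun_cong[OF xy(3), of "H #> g"] by simp
      then have "H #> (g \<otimes> x) = H #> (g \<otimes> y)" using g xy by (simp add: coset_mult_assoc H.subset)
      then have "(g \<otimes> x) \<otimes> inv (g \<otimes> y) \<in> H" using g xy by (intro rcosets_eqD assms(1)) auto
      then show ?thesis using g xy by (simp add: inv_mult_group m_assoc)
    qed
    then show "x \<otimes> inv y \<in> N" using xy by (simp add: N_def)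
  qed
  moreover have "N \<subseteq> H"
  proof
    fix y assume "y \<in> N"
    then have "\<one> \<otimes> y \<otimes> inv \<one> \<in> H" "y \<in> carrier G" unfolding N_def by blast+
    then show "y \<in> H" by simp
  qed
  ultimately show thesis using N that by blast
qed

text \<open>In a compact Hausdorff space components and quasi-components agree, so a clopen set
  separates the identity from \<open>x\<close>. It contains an open subgroup, which has finite
  index, and the core of that subgroup omits \<open>x\<close>.\<close>

theorem profinite_imp_residually_finite:
  assumes "profinite_group G T"
  shows "residually_finite G"
proof -
  have TG: "topological_group G T" and comp: "compact_space T" and H2: "Hausdorff_space T"
    and td: "totally_disconnected_space T"
    using assms by (auto simp: profinite_group_def)
  interpret group G using TG by (simp add: topological_group_def)
  have top: "topspace T = carrier G" using TG by (simp add: topological_group_def)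
  have "\<exists>N. N \<lhd> G \<and> finite (rcosets\<^bsub>G\<^esub> N) \<and> x \<notin> N"
    if x: "x \<in> carrier G" "x \<noteq> \<one>\<^bsub>G\<^esub>" for x
  proof -
    have "\<not> connected_component_of T \<one>\<^bsub>G\<^esub> x"
      using td x(2) unfolding connected_component_of_def totally_disconnected_space_def by blast
    then have "\<not> quasi_component_of T \<one>\<^bsub>G\<^esub> x"
      using quasi_eq_connected_component_of[of T "\<one>\<^bsub>G\<^esub>"] comp H2 by simp
    then obtain V where V: "\<one>\<^bsub>G\<^esub> \<in> V" "closedin T V" "openin T V" "x \<notin> V"
      using x(1) top unfolding quasi_component_of by auto
    obtain H where H: "subgroup H G" "openin T H" "H \<subseteq> V"
      using clopen_neighbourhood_contains_open_subgroup[OF TG comp V(3,2,1)] by blast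
    obtain N where "N \<lhd> G" "finite (rcosets\<^bsub>G\<^esub> N)" "N \<subseteq> H"
      using finite_index_normal_core[OF H(1) open_subgroup_finite_index[OF TG comp H(1,2)]] by blast
    then show ?thesis using H(3) V(4) by blast
  qed
  then show ?thesis by (simp add: residually_finite_def is_group)
qed


text \<open>Closedness is what preserves compactness; the other topological conditions pass to all
  subspaces.\<close>

lemma profinite_closed_subgroup:
  assumes "profinite_group G T" "subgroup H G" "closedin T H"
  shows "profinite_group (G\<lparr>carrier := H\<rparr>) (subtopology T H)"
proof -
  have TG: "topological_group G T" using assms(1) by (simp add: profinite_group_def)
  interpret group G using TG by (simp add: topological_group_def)
  have top: "topspace T = carrier G" using TG by (simp add: topological_group_def)
  interpret H: subgroup H G by fact
  have topH: "topspace (subtopology T H) = H" using H.subset top by auto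
  have mult: "continuous_map (prod_topology T T) T (\<lambda>(x, y). x \<otimes>\<^bsub>G\<^esub> y)"
    and inv: "continuous_map T T (\<lambda>x. inv\<^bsub>G\<^esub> x)"
    using TG by (auto simp: topological_group_def)
  have "topological_group (G\<lparr>carrier := H\<rparr>) (subtopology T H)"
    unfolding topological_group_def
  proof (intro conjI)
    show "group (G\<lparr>carrier := H\<rparr>)" by (rule H.subgroup_is_group) (rule is_group)
    show "topspace (subtopology T H) = carrier (G\<lparr>carrier := H\<rparr>)" using topH by simp
    have "continuous_map (prod_topology (subtopology T H) (subtopology T H)) T (\<lambda>(x, y). x \<otimes>\<^bsub>G\<^esub> y)"
      using mult by (simp add: prod_topology_subtopology subtopology_subtopology continuous_map_from_subtopology)
    then show "continuous_map (prod_topology (subtopology T H) (subtopology T H)) (subtopology T H)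
        (\<lambda>(x, y). x \<otimes>\<^bsub>G\<lparr>carrier := H\<rparr>\<^esub> y)"
      using topH by (auto simp: continuous_map_in_subtopology topspace_prod_topology)
    have "continuous_map (subtopology T H) (subtopology T H) (\<lambda>x. inv\<^bsub>G\<^esub> x)"
      using continuous_map_from_subtopology[OF inv, of H] topH by (auto simp: continuous_map_in_subtopology)
    then show "continuous_map (subtopology T H) (subtopology T H) (\<lambda>x. inv\<^bsub>G\<lparr>carrier := H\<rparr>\<^esub> x)"
      by (rule continuous_map_eq) (use topH in \<open>simp add: m_inv_consistent[OF assms(2)]\<close>)
  qed
  then show ?thesis
    using assms(1,3) unfolding profinite_group_def totally_disconnected_space_def
    by (auto simp: compact_space_subtopology closedin_compact_space Hausdorff_space_subtopology
        connectedin_subtopology)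
qed

section \<open>Fibre products as virtually pro-\<open>p\<close> groups\<close>

text \<open>\<open>\<pi>\<close> identifies \<open>D\<close> with the fibre product of the
  \<open>Q i\<close> over \<open>F\<close>, and an abstract \<open>D\<close> may have elements of
  any type. The fibre product is closed in a product of finite discrete groups, hence profinite, and
  the kernel of its map to \<open>F\<close> is open. Modulo an open subgroup of that kernel only
  finitely many coordinates matter, each in a finite \<open>p\<close>-group, so
  \<open>prime_power_index\<close> applies.\<close>

lemma fibre_product_virtually_pro_p:
  fixes D :: "('d, 'm) monoid_scheme" and Q :: "nat \<Rightarrow> ('q, 'k) monoid_scheme" and F :: "('f, 'n) monoid_scheme"
  assumes "prime p" and D: "group D"
    and hom: "\<And>i. group_hom D (Q i) (\<lambda>x. \<pi> x i)"
    and inj: "inj_on \<pi> (carrier D)"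
    and image: "\<pi> ` carrier D = {h. (\<forall>i. h i \<in> carrier (Q i)) \<and> (\<forall>i. \<phi> i (h i) = \<phi> 0 (h 0))}"
    and \<phi>: "\<And>i. group_hom (Q i) F (\<phi> i)" "\<And>i. finite (carrier (Q i))"
      "\<And>i. \<phi> i ` carrier (Q i) = carrier F"
    and ord: "\<And>i. order (Q i) = order F * p ^ n i"
  shows "\<exists>T. virtually_pro_p_group p D T"
proof -
  interpret D: group D by (rule D)
  interpret \<pi>: group_hom D "Q i" "\<lambda>x. \<pi> x i" for i by (rule hom)
  interpret \<phi>: group_hom "Q i" F "\<phi> i" for i by (rule \<phi>)
  define X where "X = product_topology (\<lambda>i. discrete_topology (carrier (Q i))) UNIV"
  define E where "E = {h. (\<forall>i. h i \<in> carrier (Q i)) \<and> (\<forall>i. \<phi> i (h i) = \<phi> 0 (h 0))}"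
  define T where "T = pullback_topology (carrier D) \<pi> X"
  define \<sigma> where "\<sigma> = inv_into (carrier D) \<pi>"
  have topX: "topspace X = {h. \<forall>i. h i \<in> carrier (Q i)}"
    by (auto simp: X_def topspace_product_topology PiE_UNIV_domain)
  have top: "topspace T = carrier D" by (auto simp: T_def topspace_pullback_topology topX)
  have cont_\<pi>: "continuous_map T X \<pi>"
    using continuous_map_pullback[of X X id "carrier D" \<pi>] by (simp add: T_def)
  have proj: "continuous_map X (discrete_topology (carrier (Q i))) (\<lambda>h. h i)" for i
    unfolding X_def using continuous_map_product_projection[of i UNIV "\<lambda>i. discrete_topology (carrier (Q i))"] by simp
  have cont_proj: "continuous_map T (discrete_topology (carrier (Q i))) (\<lambda>x. \<pi> x i)" for i
    using continuous_map_compose[OF cont_\<pi> proj] by (simp add: comp_def)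
  \<comment> \<open>Continuity into \<open>T\<close> is tested on coordinates, where the group
    operations become maps between discrete spaces.\<close>
  have into_T: "continuous_map Y T f"
    if "\<And>i. continuous_map Y (discrete_topology (carrier (Q i))) (\<lambda>y. \<pi> (f y) i)"
      "\<And>y. y \<in> topspace Y \<Longrightarrow> f y \<in> carrier D" for Y :: "'y topology" and f
    unfolding T_def
  proof (rule continuous_map_pullback')
    show "continuous_map Y X (\<pi> \<circ> f)"
      using that(1) by (simp add: X_def continuous_map_componentwise_UNIV)
  qed (use that(2) in auto)
  have "closedin X E"
  proof -
    have cont: "continuous_map X (discrete_topology UNIV) (\<lambda>h. \<phi> i (h i))" for i
      using continuous_map_compose[OF proj, of i "discrete_topology UNIV" "\<phi> i"] by (simp add: comp_def)
    have "closedin X {h \<in> topspace X. \<phi> i (h i) = \<phi> 0 (h 0)}" for i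
      by (rule closedin_continuous_maps_eq[OF _ cont cont]) simp
    then have "closedin X (\<Inter>i. {h \<in> topspace X. \<phi> i (h i) = \<phi> 0 (h 0)})"
      by (intro closedin_Inter) auto
    also have "(\<Inter>i. {h \<in> topspace X. \<phi> i (h i) = \<phi> 0 (h 0)}) = E" by (auto simp: E_def topX)
    finally show ?thesis .
  qed
  have compX: "compact_space X" using \<phi>(2) by (simp add: X_def compact_space_product_topology compact_space_discrete_topology)
  have H2X: "Hausdorff_space X" by (simp add: X_def Hausdorff_space_product_topology)
  have img: "\<pi> ` carrier D = E" by (simp add: image E_def)
  have \<sigma>: "\<sigma> h \<in> carrier D" "\<pi> (\<sigma> h) = h" if "h \<in> E" for h
    using that unfolding img[symmetric] \<sigma>_def by (auto simp: inv_into_into f_inv_into_f)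
  have topE: "topspace (subtopology X E) = E" by (auto simp: topX E_def)
  \<comment> \<open>Through this, compactness and the Hausdorff property come from the closed
    subspace \<open>E\<close> of the product.\<close>
  have "homeomorphic_maps T (subtopology X E) \<pi> \<sigma>"
    unfolding homeomorphic_maps_def
  proof (intro conjI ballI)
    show "continuous_map T (subtopology X E) \<pi>"
      using cont_\<pi> img top by (auto simp: continuous_map_in_subtopology)
    show "continuous_map (subtopology X E) T \<sigma>"
    proof (rule into_T)
      fix i
      have "continuous_map (subtopology X E) (discrete_topology (carrier (Q i))) (\<lambda>h. h i)"
        by (rule continuous_map_from_subtopology[OF proj])
      then show "continuous_map (subtopology X E) (discrete_topology (carrier (Q i))) (\<lambda>y. \<pi> (\<sigma> y) i)"
        by (rule continuous_map_eq) (use topE \<sigma> in simp)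
    qed (use topE \<sigma> in simp)
    fix x assume "x \<in> topspace T"
    then show "\<sigma> (\<pi> x) = x" using inj top by (simp add: \<sigma>_def)
  qed (use topE \<sigma> in simp)
  then have homeo: "T homeomorphic_space subtopology X E" by (auto simp: homeomorphic_space_def)
  have compT: "compact_space T"
    using homeomorphic_compact_space[OF homeo] closedin_compact_space[OF compX \<open>closedin X E\<close>]
    by (simp add: compact_space_subtopology)
  have H2T: "Hausdorff_space T"
    using homeomorphic_Hausdorff_space[OF homeo] Hausdorff_space_subtopology[OF H2X] by simp
  have td: "totally_disconnected_space T"
    unfolding totally_disconnected_space_def
  proof (intro allI impI)
    fix S assume S: "connectedin T S"
    have "x = y" if "x \<in> S" "y \<in> S" for x y
    proof (rule inj_onD[OF inj])
      show "x \<in> carrier D" "y \<in> carrier D" using that connectedin_subset_topspace[OF S] top by auto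
      show "\<pi> x = \<pi> y"
      proof
        fix i
        have "connectedin (discrete_topology (carrier (Q i))) ((\<lambda>x. \<pi> x i) ` S)"
          by (rule connectedin_continuous_map_image[OF cont_proj S])
        then show "\<pi> x i = \<pi> y i" using that by (auto simp: connectedin_discrete_topology)
      qed
    qed
    then show "\<exists>a. S \<subseteq> {a}" by blast
  qed
  have TG: "topological_group D T"
    unfolding topological_group_def
  proof (intro conjI D top)
    show "continuous_map (prod_topology T T) T (\<lambda>(x, y). x \<otimes>\<^bsub>D\<^esub> y)"
    proof (rule into_T)
      fix i
      let ?d = "discrete_topology (carrier (Q i))"
      have "continuous_map (prod_topology T T) (prod_topology ?d ?d) (\<lambda>z. (\<pi> (fst z) i, \<pi> (snd z) i))"
        using continuous_map_compose[OF continuous_map_fst cont_proj] continuous_map_compose[OF continuous_map_snd cont_proj]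
        by (auto intro!: continuous_map_pairedI simp: comp_def)
      moreover have "continuous_map (prod_topology ?d ?d) ?d (\<lambda>(x, y). x \<otimes>\<^bsub>Q i\<^esub> y)"
        by (auto simp: prod_topology_discrete_topology[symmetric])
      ultimately have "continuous_map (prod_topology T T) ?d (\<lambda>z. \<pi> (fst z) i \<otimes>\<^bsub>Q i\<^esub> \<pi> (snd z) i)"
        by (auto dest: continuous_map_compose simp: comp_def)
      then show "continuous_map (prod_topology T T) ?d (\<lambda>z. \<pi> (case z of (x, y) \<Rightarrow> x \<otimes>\<^bsub>D\<^esub> y) i)"
        by (rule continuous_map_eq) (auto simp: top \<pi>.hom_mult)
    qed (auto simp: top)
    show "continuous_map T T (\<lambda>x. inv\<^bsub>D\<^esub> x)"
    proof (rule into_T)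
      fix i
      let ?d = "discrete_topology (carrier (Q i))"
      have "continuous_map ?d ?d (\<lambda>x. inv\<^bsub>Q i\<^esub> x)" by auto
      from continuous_map_compose[OF cont_proj this]
      have "continuous_map T ?d (\<lambda>x. inv\<^bsub>Q i\<^esub> (\<pi> x i))" by (simp add: comp_def)
      then show "continuous_map T ?d (\<lambda>x. \<pi> (inv\<^bsub>D\<^esub> x) i)"
        by (rule continuous_map_eq) (auto simp: top \<pi>.hom_inv)
    qed (auto simp: top)
  qed
  have prof: "profinite_group D T" by (simp add: profinite_group_def TG compT H2T td)
  \<comment> \<open>The kernel of the common map to \<open>F\<close>, read off at coordinate 0;
    depending on one discrete coordinate only, it is clopen.\<close>
  define H where "H = {x \<in> carrier D. \<phi> 0 (\<pi> x 0) = \<one>\<^bsub>F\<^esub>}"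
  have Hpre: "H = {x \<in> topspace T. \<pi> x 0 \<in> {y \<in> carrier (Q 0). \<phi> 0 y = \<one>\<^bsub>F\<^esub>}}"
    by (auto simp: H_def top)
  have openH: "openin T H" and closedH: "closedin T H"
    unfolding Hpre by (rule openin_continuous_map_preimage[OF cont_proj] closedin_continuous_map_preimage[OF cont_proj]; auto)+
  have H: "subgroup H D"
    by (rule D.subgroupI) (auto simp: H_def \<pi>.hom_mult \<pi>.hom_inv \<pi>.hom_one intro!: exI[of _ "\<one>\<^bsub>D\<^esub>"])
  let ?DH = "D\<lparr>carrier := H\<rparr>"
  have profH: "profinite_group ?DH (subtopology T H)"
    by (rule profinite_closed_subgroup[OF prof H closedH])
  interpret DH: group ?DH using H D by (rule subgroup.subgroup_is_group)
  have "\<exists>k. card (rcosets\<^bsub>?DH\<^esub> N) = p ^ k" if N: "N \<lhd> ?DH" "openin (subtopology T H) N" for N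
  proof (rule DH.prime_power_index[OF N(1) _ \<open>prime p\<close>])
    have sub: "subgroup N ?DH" using N(1) by (rule normal_imp_subgroup)
    show "finite (rcosets\<^bsub>?DH\<^esub> N)"
      using profH N(2) sub by (intro open_subgroup_finite_index[of ?DH "subtopology T H"]) (auto simp: profinite_group_def)
    have "openin T N" using N(2) openH by (simp add: openin_open_subtopology)
    then obtain U where U: "openin X U" "N = \<pi> -` U \<inter> carrier D"
      by (auto simp: T_def openin_pullback_topology)
    have oneU: "\<pi> \<one>\<^bsub>D\<^esub> \<in> U" using subgroup.one_closed[OF sub] U(2) by simp
    \<comment> \<open>A basic neighbourhood of the identity inside \<open>U\<close> constrains only
      finitely many coordinates.\<close>
    then obtain Y where Y: "\<pi> \<one>\<^bsub>D\<^esub> \<in> (\<Pi>\<^sub>E i\<in>UNIV. Y i)" "finite {i. Y i \<noteq> carrier (Q i)}" "(\<Pi>\<^sub>E i\<in>UNIV. Y i) \<subseteq> U"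
      using product_topology_open_contains_basis[OF U(1)[unfolded X_def] oneU] by auto
    \<comment> \<open>One exponent for all constrained coordinates: there the kernel has order
      \<open>p ^ n i\<close>, and \<open>n i\<close> is at most the sum \<open>s\<close>.\<close>
    define s where "s = (\<Sum>i\<in>{i. Y i \<noteq> carrier (Q i)}. n i)"
    fix x assume "x \<in> carrier ?DH"
    then have x: "x \<in> carrier D" "x \<in> H" by (auto simp: H_def)
    have "\<pi> (x [^]\<^bsub>D\<^esub> (p ^ s)) i \<in> Y i" for i
    proof (cases "Y i = carrier (Q i)")
      case False
      let ?K = "kernel (Q i) F (\<phi> i)"
      interpret K: group "(Q i)\<lparr>carrier := ?K\<rparr>"
        by (rule subgroup.subgroup_is_group[OF \<phi>.subgroup_kernel]) (rule \<pi>.H.is_group)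
      have "order F > 0" using \<phi>(2)[of 0] unfolding \<phi>.H.order_gt_0_iff_finite \<phi>(3)[of 0, symmetric] by simp
      then have cardK: "card ?K = p ^ n i"
        using \<phi>.order_eq_order_kernel[OF \<phi>(2,3)] ord[of i] by simp
      have "\<phi> i (\<pi> x i) = \<phi> 0 (\<pi> x 0)" using img x(1) unfolding E_def by blast
      then have xK: "\<pi> x i \<in> ?K" using x by (simp add: kernel_def H_def)
      have "n i \<le> s" using False Y(2) unfolding s_def by (intro member_le_sum) auto
      then have ps: "p ^ s = p ^ n i * p ^ (s - n i)" by (simp flip: power_add)
      have "\<pi> x i [^]\<^bsub>Q i\<^esub> (p ^ n i) = \<one>\<^bsub>Q i\<^esub>"
        using K.pow_order_eq_1[of "\<pi> x i"] xK cardK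
        by (simp add: order_def \<pi>.H.nat_pow_consistent[of i _ _ ?K])
      then have "\<pi> x i [^]\<^bsub>Q i\<^esub> (p ^ s) = \<one>\<^bsub>Q i\<^esub>"
        using x(1) unfolding ps by (simp add: \<pi>.H.nat_pow_pow[symmetric])
      moreover have "\<pi> \<one>\<^bsub>D\<^esub> i \<in> Y i" using Y(1) by auto
      ultimately show ?thesis using x(1) by (simp add: \<pi>.hom_nat_pow)
    qed (use x in auto)
    then have "x [^]\<^bsub>D\<^esub> (p ^ s) \<in> N" using Y(3) x U(2) by (auto simp: PiE_UNIV_domain)
    then show "\<exists>s::nat. x [^]\<^bsub>?DH\<^esub> (p ^ s) \<in> N" by (auto simp: D.nat_pow_consistent[of _ _ H])
  qed
  then have "pro_p_group p ?DH (subtopology T H)"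
    using \<open>prime p\<close> profH by (auto simp: pro_p_group_def)
  then have "virtually_pro_p_group p D T"
    using prof H openH by (auto simp: virtually_pro_p_group_def)
  then show ?thesis by blast
qed

section \<open>Conciseness\<close>


text \<open>A function is encoded by its graph, a set of coded pairs.\<close>

lemma nat_functions_lepoll_reals: "(UNIV :: (nat \<Rightarrow> nat) set) \<lesssim> (UNIV :: real set)"
proof -
  have "inj (\<lambda>f :: nat \<Rightarrow> nat. range (\<lambda>n. prod_encode (n, f n)))"
  proof (rule injI, rule ext)
    fix f g :: "nat \<Rightarrow> nat" and n
    assume eq: "range (\<lambda>n. prod_encode (n, f n)) = range (\<lambda>n. prod_encode (n, g n))"
    have "prod_encode (n, f n) \<in> range (\<lambda>n. prod_encode (n, g n))" unfolding eq[symmetric] by blast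
    then show "f n = g n" by auto
  qed
  then have "(UNIV :: (nat \<Rightarrow> nat) set) \<lesssim> (UNIV :: nat set set)" by (auto simp: lepoll_def)
  also have "\<dots> \<lesssim> (UNIV :: real set)" using nat_sets_eqpoll_reals by (rule eqpoll_imp_lepoll)
  finally show ?thesis .
qed

text \<open>If no bound existed, covers \<open>Q i\<close> with more than \<open>i\<close> elements
  in the verbal subgroup would have a fibre product with finitely many word values but a verbal
  subgroup mapping onto all of theirs.\<close>

lemma value_cover_bound_if_concise:
  fixes F :: "('f, 'n) monoid_scheme"
  assumes "(UNIV :: real set) \<lesssim> (UNIV :: 'b set)"
    and "concise_in w (virtually_pro_p_groups :: 'b monoid set)" "prime p"
  shows "\<exists>B. \<forall>(Q :: nat monoid) \<phi> n. value_cover w Q F \<phi> \<and> order Q = order F * p ^ n \<longrightarrow>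
    card (verbal_subgroup Q w) \<le> B"
proof (rule ccontr)
  assume "\<nexists>B. \<forall>(Q :: nat monoid) \<phi> n. value_cover w Q F \<phi> \<and> order Q = order F * p ^ n \<longrightarrow>
    card (verbal_subgroup Q w) \<le> B"
  then have "\<forall>B. \<exists>(Q :: nat monoid) \<phi> n. value_cover w Q F \<phi> \<and> order Q = order F * p ^ n \<and>
    B < card (verbal_subgroup Q w)"
    by (simp add: not_le)
  then obtain Q :: "nat \<Rightarrow> nat monoid" and \<phi> n where Q: "\<And>i. value_cover w (Q i) F (\<phi> i)"
    "\<And>i. order (Q i) = order F * p ^ n i" "\<And>i. i < card (verbal_subgroup (Q i) w)"
    by metis
  note cover = value_coverD[OF Q(1)]
  interpret \<phi>: group_hom "Q i" F "\<phi> i" for i by (rule cover)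
  define P where "P = product_group UNIV Q"
  define E where "E = {h. (\<forall>i. h i \<in> carrier (Q i)) \<and> (\<forall>i. \<phi> i (h i) = \<phi> 0 (h 0))}"
  define D0 where "D0 = P\<lparr>carrier := E\<rparr>"
  have P: "group P" unfolding P_def by (rule product_group) (rule \<phi>.G.group_axioms)
  have carP: "carrier P = {h. \<forall>i. h i \<in> carrier (Q i)}" by (auto simp: P_def PiE_UNIV_domain)
  have multP: "h \<otimes>\<^bsub>P\<^esub> h' = (\<lambda>i. h i \<otimes>\<^bsub>Q i\<^esub> h' i)" for h h' by (simp add: P_def restrict_def)
  have invP: "inv\<^bsub>P\<^esub> h = (\<lambda>i. inv\<^bsub>Q i\<^esub> h i)" if "h \<in> carrier P" for h
    using that \<phi>.G.group_axioms by (simp add: P_def restrict_def)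
  have E: "subgroup E P"
  proof (rule group.subgroupI[OF P])
    show "E \<noteq> {}" by (auto simp: E_def intro!: exI[of _ "\<lambda>i. \<one>\<^bsub>Q i\<^esub>"])
    fix h assume h: "h \<in> E"
    then have hP: "h \<in> carrier P" by (simp add: E_def carP)
    have eq: "\<phi> i (k i) = \<phi> 0 (k 0)" "k i \<in> carrier (Q i)" if "k \<in> E" for k i
      using that unfolding E_def by blast+
    have "\<phi> i (inv\<^bsub>Q i\<^esub> h i) = \<phi> 0 (inv\<^bsub>Q 0\<^esub> h 0)" "inv\<^bsub>Q i\<^esub> h i \<in> carrier (Q i)" for i
      using eq(2)[OF h] eq(1)[OF h, of i] by simp_all
    then show "inv\<^bsub>P\<^esub> h \<in> E" unfolding invP[OF hP] E_def by blast
    fix h' assume h': "h' \<in> E"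
    have "\<phi> i (h i \<otimes>\<^bsub>Q i\<^esub> h' i) = \<phi> 0 (h 0 \<otimes>\<^bsub>Q 0\<^esub> h' 0)" "h i \<otimes>\<^bsub>Q i\<^esub> h' i \<in> carrier (Q i)" for i
      using eq(2)[OF h] eq(2)[OF h'] eq(1)[OF h, of i] eq(1)[OF h', of i] by simp_all
    then show "h \<otimes>\<^bsub>P\<^esub> h' \<in> E" unfolding multP E_def by blast
  qed (auto simp: E_def carP)
  have D0: "group D0" unfolding D0_def using E P by (rule subgroup.subgroup_is_group)
  \<comment> \<open>Elements of the product are functions on the naturals with natural values, so a
    type as large as the reals has room for a copy.\<close>
  obtain f :: "(nat \<Rightarrow> nat) \<Rightarrow> 'b" where "inj f"
    using lepoll_trans[OF nat_functions_lepoll_reals assms(1)] by (auto simp: lepoll_def)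
  then have inj_f: "inj_on f (carrier D0)" by (rule inj_on_subset) simp
  define D where "D = image_group f D0"
  have D: "group D" and f: "f \<in> iso D0 D"
    unfolding D_def by (rule image_group_iso[OF D0 inj_f])+
  define \<pi> where "\<pi> = inv_into (carrier D0) f"
  have \<pi>: "\<pi> \<in> iso D D0" unfolding \<pi>_def by (rule group.iso_set_sym[OF D0 f])
  have inj_\<pi>: "inj_on \<pi> (carrier D)" and img_\<pi>: "\<pi> ` carrier D = E"
    using \<pi> by (auto simp: iso_def bij_betw_def D0_def)
  have hom_\<pi>: "group_hom D (Q i) (\<lambda>x. \<pi> x i)" for i
  proof (rule group_hom.intro[OF D \<phi>.G.group_axioms], rule group_hom_axioms.intro, rule homI)
    fix x assume "x \<in> carrier D"
    then show "\<pi> x i \<in> carrier (Q i)" using img_\<pi> by (auto simp: E_def)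
    fix y assume "y \<in> carrier D"
    then have "\<pi> (x \<otimes>\<^bsub>D\<^esub> y) = \<pi> x \<otimes>\<^bsub>D0\<^esub> \<pi> y"
      using \<open>x \<in> carrier D\<close> \<pi> by (auto simp: iso_def hom_mult)
    then show "\<pi> (x \<otimes>\<^bsub>D\<^esub> y) i = \<pi> x i \<otimes>\<^bsub>Q i\<^esub> \<pi> y i" by (simp add: D0_def multP)
  qed
  have "\<exists>T. virtually_pro_p_group p D T"
    using img_\<pi> unfolding E_def
    by (intro fibre_product_virtually_pro_p[where \<pi> = \<pi> and \<phi> = \<phi> and Q = Q and F = F and n = n]
        assms(3) D hom_\<pi> inj_\<pi> cover(1-3) Q(2))
  then have "D \<in> virtually_pro_p_groups"
    using assms(3) by (auto simp: virtually_pro_p_groups_def)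
  moreover have "finite (word_values D w)"
  proof (rule finite_word_values_if_factor[OF D])
    let ?\<psi> = "\<lambda>x. \<phi> 0 (\<pi> x 0)"
    interpret \<pi>: group_hom D "Q i" "\<lambda>x. \<pi> x i" for i by (rule hom_\<pi>)
    have "?\<psi> ` carrier D \<subseteq> \<phi> 0 ` carrier (Q 0)" by auto
    then show "finite (?\<psi> ` carrier D)" using cover(2) by (meson finite_imageI finite_subset)
    fix g g' :: "nat \<Rightarrow> 'b"
    assume g: "\<And>i. g i \<in> carrier D" and g': "\<And>i. g' i \<in> carrier D" and eq: "\<And>i. ?\<psi> (g i) = ?\<psi> (g' i)"
    \<comment> \<open>All coordinates of an element of \<open>D\<close> have the same image in
      \<open>F\<close>, and each \<open>Q i\<close> is a cover; so images at coordinate 0 determine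
      the value in every coordinate.\<close>
    have "\<pi> (word_eval D g w) i = \<pi> (word_eval D g' w) i" for i
    proof -
      have fib: "\<phi> i (\<pi> x i) = ?\<psi> x" if "x \<in> carrier D" for x
        using that img_\<pi> unfolding E_def by blast
      have "word_eval (Q i) (\<lambda>j. \<pi> (g j) i) w = word_eval (Q i) (\<lambda>j. \<pi> (g' j) i) w"
        by (rule cover(4)) (simp_all add: g g' fib eq)
      then show ?thesis by (simp add: word_eval_hom[OF hom_\<pi>] g g')
    qed
    then have "\<pi> (word_eval D g w) = \<pi> (word_eval D g' w)" by (rule ext)
    then show "word_eval D g w = word_eval D g' w"
      by (rule inj_onD[OF inj_\<pi>]) (simp_all add: word_eval_closed D g g')
  qed
  ultimately have fin: "finite (verbal_subgroup D w)"
    using assms(2) unfolding concise_in_def by blast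
  \<comment> \<open>The choice that contradicts \<open>Q(3)\<close>: the verbal subgroup of
    \<open>Q i\<close> has more than \<open>i\<close> elements, yet is an image of that of
    \<open>D\<close>.\<close>
  define i where "i = card (verbal_subgroup D w)"
  have "(\<lambda>x. \<pi> x i) ` carrier D = carrier (Q i)"
  proof
    show "(\<lambda>x. \<pi> x i) ` carrier D \<subseteq> carrier (Q i)" using img_\<pi> by (auto simp: E_def)
    show "carrier (Q i) \<subseteq> (\<lambda>x. \<pi> x i) ` carrier D"
    proof
      fix q assume q: "q \<in> carrier (Q i)"
      have "\<exists>r\<in>carrier (Q j). \<phi> j r = \<phi> i q" for j
        using cover(3)[of j] \<phi>.hom_closed[OF q] by (metis imageE)
      then obtain r where r: "\<And>j. r j \<in> carrier (Q j)" "\<And>j. \<phi> j (r j) = \<phi> i q" by metis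
      \<comment> \<open>A compatible family through \<open>q\<close>: every other coordinate is
        chosen over the same element of \<open>F\<close>.\<close>
      have "r(i := q) \<in> E" using q r by (auto simp: E_def)
      then obtain x where "x \<in> carrier D" "\<pi> x = r(i := q)" using img_\<pi> by (metis imageE)
      then show "q \<in> (\<lambda>x. \<pi> x i) ` carrier D" by (intro image_eqI[of _ _ x]) simp_all
    qed
  qed
  then have "verbal_subgroup (Q i) w = (\<lambda>x. \<pi> x i) ` verbal_subgroup D w"
    by (rule verbal_subgroup_image[OF hom_\<pi>])
  then have "card (verbal_subgroup (Q i) w) \<le> i" using fin by (simp add: card_image_le i_def)
  then show False using Q(3)[of i] by simp
qed

section \<open>Conciseness in residually finite groups\<close>

lemma (in group) finite_index_normal_Int:
  assumes "N1 \<lhd> G" "finite (rcosets N1)" "N2 \<lhd> G" "finite (rcosets N2)"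
  shows "N1 \<inter> N2 \<lhd> G" "finite (rcosets (N1 \<inter> N2))"
proof -
  show N: "N1 \<inter> N2 \<lhd> G" using assms(1,3) by (rule normal_subgroup_intersect)
  note sub = assms(1,3)[THEN normal_imp_subgroup]
  show "finite (rcosets (N1 \<inter> N2))"
  proof (rule finite_rcosetsI[OF normal_imp_subgroup[OF N]])
    let ?c = "\<lambda>x. (N1 #> x, N2 #> x)"
    have "?c ` carrier G \<subseteq> (rcosets N1) \<times> (rcosets N2)" by (auto simp: RCOSETS_def)
    then show "finite (?c ` carrier G)" using assms(2,4) by (meson finite_SigmaI finite_subset)
    fix x y assume "x \<in> carrier G" "y \<in> carrier G" "?c x = ?c y"
    then show "x \<otimes> inv y \<in> N1 \<inter> N2" using rcosets_eqD[OF sub(1)] rcosets_eqD[OF sub(2)] by blast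
  qed
qed

lemma residually_finite_avoids_finite_set:
  assumes "residually_finite G" "finite A" "A \<subseteq> carrier G - {\<one>\<^bsub>G\<^esub>}"
  shows "\<exists>N. N \<lhd> G \<and> finite (rcosets\<^bsub>G\<^esub> N) \<and> A \<inter> N = {}"
proof -
  interpret group G using assms(1) by (simp add: residually_finite_def)
  show ?thesis
    using assms(2,3)
  proof (induction A rule: finite_induct)
    case empty
    have "finite (rcosets\<^bsub>G\<^esub> (carrier G))"
      by (rule finite_rcosetsI[of _ "\<lambda>x. ()"]) (auto simp: subgroup_self)
    then show ?case using normal_self by blast
  next
    case (insert x A)
    then obtain N1 where N1: "N1 \<lhd> G" "finite (rcosets\<^bsub>G\<^esub> N1)" "A \<inter> N1 = {}" by blast
    obtain N2 where N2: "N2 \<lhd> G" "finite (rcosets\<^bsub>G\<^esub> N2)" "x \<notin> N2"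
      using assms(1) insert.prems unfolding residually_finite_def by blast
    show ?case using finite_index_normal_Int[OF N1(1,2) N2(1,2)] N1(3) N2(3)
      by (intro exI[of _ "N1 \<inter> N2"]) blast
  qed
qed

text \<open>Only finitely many nontrivial elements arise as \<open>x\<close> times the inverse of
  \<open>y\<close> with both in \<open>A\<close>, so one \<open>N\<close> avoids them all.\<close>

lemma residually_finite_separates:
  assumes "residually_finite G" "finite A" "A \<subseteq> carrier G"
  obtains N where "N \<lhd> G" "finite (rcosets\<^bsub>G\<^esub> N)"
    "\<And>x y. x \<in> A \<Longrightarrow> y \<in> A \<Longrightarrow> x \<otimes>\<^bsub>G\<^esub> inv\<^bsub>G\<^esub> y \<in> N \<Longrightarrow> x = y"
proof -
  interpret group G using assms(1) by (simp add: residually_finite_def)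
  define S where "S = (\<lambda>(x, y). x \<otimes>\<^bsub>G\<^esub> inv\<^bsub>G\<^esub> y) ` {(x, y). x \<in> A \<and> y \<in> A \<and> x \<noteq> y}"
  have "finite S" unfolding S_def
    by (intro finite_imageI finite_subset[OF _ finite_cartesian_product[OF assms(2,2)]]) auto
  moreover have "S \<subseteq> carrier G - {\<one>\<^bsub>G\<^esub>}"
  proof
    fix z assume "z \<in> S"
    then obtain x y where xy: "x \<in> A" "y \<in> A" "x \<noteq> y" "z = x \<otimes>\<^bsub>G\<^esub> inv\<^bsub>G\<^esub> y" by (auto simp: S_def)
    then have "x \<in> carrier G" "y \<in> carrier G" using assms(3) by auto
    then show "z \<in> carrier G - {\<one>\<^bsub>G\<^esub>}" using xy by (auto dest: inv_equality)
  qed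
  ultimately obtain N where N: "N \<lhd> G" "finite (rcosets\<^bsub>G\<^esub> N)" "S \<inter> N = {}"
    using residually_finite_avoids_finite_set[OF assms(1)] by blast
  show thesis
  proof (rule that[OF N(1,2)])
    fix x y assume "x \<in> A" "y \<in> A" "x \<otimes>\<^bsub>G\<^esub> inv\<^bsub>G\<^esub> y \<in> N"
    then show "x = y" using N(3) unfolding S_def by blast
  qed
qed

text \<open>With \<open>B\<close> bounding all covers of \<open>G Mod N0\<close>, an infinite verbal
  subgroup has \<open>Suc B\<close> elements. A finite quotient that keeps them apart and still
  covers \<open>G Mod N0\<close> contradicts the bound.\<close>

theorem concise_in_residually_finite_groups:
  fixes w :: group_word
  assumes "(UNIV :: real set) \<lesssim> (UNIV :: 'b set)"
    and "concise_in w (virtually_pro_p_groups :: 'b monoid set)"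
  shows "concise_in w (residually_finite_groups :: 'a monoid set)"
  unfolding concise_in_def
proof (intro ballI impI, rule ccontr)
  fix G :: "'a monoid"
  assume "G \<in> residually_finite_groups" and fin: "finite (word_values G w)"
    and inf: "infinite (verbal_subgroup G w)"
  then have rf: "residually_finite G" by (simp add: residually_finite_groups_def)
  interpret group G using rf by (simp add: residually_finite_def)
  obtain N0 where N0: "N0 \<lhd> G" "finite (rcosets\<^bsub>G\<^esub> N0)"
    and sep0: "\<And>x y. x \<in> word_values G w \<Longrightarrow> y \<in> word_values G w \<Longrightarrow> x \<otimes>\<^bsub>G\<^esub> inv\<^bsub>G\<^esub> y \<in> N0 \<Longrightarrow> x = y"
    using residually_finite_separates[OF rf fin word_values_subset[OF is_group]] by metis
  interpret N0: normal N0 G by (rule N0)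
  let ?F = "G Mod N0"
  have F: "group ?F" by (rule N0.factorgroup_is_group)
  have hom0: "group_hom G ?F ((#>\<^bsub>G\<^esub>) N0)"
    using N0.r_coset_hom_Mod F by (simp add: group_hom_def group_hom_axioms_def is_group)
  have onto0: "(#>\<^bsub>G\<^esub>) N0 ` carrier G = carrier ?F" by (simp add: carrier_FactGroup)
  have "finite (carrier ?F)" using N0(2) by (simp add: FactGroup_def)
  then obtain B where B: "\<And>(Q :: nat monoid) \<phi>. value_cover w Q ?F \<phi> \<Longrightarrow> card (verbal_subgroup Q w) \<le> B"
    using value_cover_bound[OF value_cover_bound_if_concise[OF assms] F] by blast
  obtain A where A: "A \<subseteq> verbal_subgroup G w" "finite A" "card A = Suc B"
    using infinite_arbitrarily_large[OF inf] by blast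
  have AG: "A \<subseteq> carrier G" using A(1) verbal_subgroup_subset[OF is_group] by blast
  obtain N1 where N1: "N1 \<lhd> G" "finite (rcosets\<^bsub>G\<^esub> N1)"
    and sep1: "\<And>x y. x \<in> A \<Longrightarrow> y \<in> A \<Longrightarrow> x \<otimes>\<^bsub>G\<^esub> inv\<^bsub>G\<^esub> y \<in> N1 \<Longrightarrow> x = y"
    using residually_finite_separates[OF rf A(2) AG] by metis
  \<comment> \<open>Being inside \<open>N0\<close>, it lets the quotient map onto \<open>?F\<close>;
    being inside \<open>N1\<close>, it keeps the elements of \<open>A\<close> distinct.\<close>
  define N where "N = N0 \<inter> N1"
  have "N \<lhd> G" and finN: "finite (rcosets\<^bsub>G\<^esub> N)"
    unfolding N_def by (rule finite_index_normal_Int[OF N0 N1])+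
  interpret N: normal N G by fact
  have "finite (carrier (G Mod N))" using finN by (simp add: FactGroup_def)
  then obtain Q :: "nat monoid" and f where Q: "group Q" "f \<in> iso (G Mod N) Q"
    using finite_group_iso_nat[OF N.factorgroup_is_group] by blast
  define h where "h x = f (N #>\<^bsub>G\<^esub> x)" for x
  have f: "inj_on f (carrier (G Mod N))" "f ` carrier (G Mod N) = carrier Q"
    using Q(2) by (auto simp: iso_def bij_betw_def)
  have "h \<in> hom G Q"
    using Group.hom_compose[OF N.r_coset_hom_Mod, of f Q] Q(2) unfolding h_def[abs_def]
    by (simp add: iso_def comp_def)
  then have hom: "group_hom G Q h" using Q(1) by (simp add: group_hom_def group_hom_axioms_def is_group)
  have onto: "h ` carrier G = carrier Q"
    unfolding f(2)[symmetric] by (auto simp: h_def carrier_FactGroup)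
  have h_eqD: "x \<otimes>\<^bsub>G\<^esub> inv\<^bsub>G\<^esub> y \<in> N" if "x \<in> carrier G" "y \<in> carrier G" "h x = h y" for x y
  proof -
    have "N #>\<^bsub>G\<^esub> x = N #>\<^bsub>G\<^esub> y"
      using that by (intro inj_onD[OF f(1)]) (auto simp: h_def carrier_FactGroup)
    then show ?thesis using that by (intro rcosets_eqD N.subgroup_axioms)
  qed
  have finQ: "finite (carrier Q)" using \<open>finite (carrier (G Mod N))\<close> unfolding f(2)[symmetric] by simp
  \<comment> \<open>Assignments congruent modulo \<open>N0\<close> have congruent values, and
    \<open>N0\<close> separates the finitely many values.\<close>
  have determined: "word_eval G g w = word_eval G g' w"
    if g: "\<And>i. g i \<in> carrier G" and g': "\<And>i. g' i \<in> carrier G"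
      and eq: "\<And>i. N0 #>\<^bsub>G\<^esub> g i = N0 #>\<^bsub>G\<^esub> g' i" for g g'
  proof (rule sep0)
    show "word_eval G g w \<in> word_values G w" "word_eval G g' w \<in> word_values G w"
      using g g' by (auto simp: word_values_def)
    have "N0 #>\<^bsub>G\<^esub> word_eval G g w = N0 #>\<^bsub>G\<^esub> word_eval G g' w"
      unfolding word_eval_hom[OF hom0 g] word_eval_hom[OF hom0 g'] by (simp add: eq)
    then show "word_eval G g w \<otimes>\<^bsub>G\<^esub> inv\<^bsub>G\<^esub> word_eval G g' w \<in> N0"
      by (intro rcosets_eqD N0.subgroup_axioms word_eval_closed is_group g g')
  qed
  have "N0 #>\<^bsub>G\<^esub> x = N0 #>\<^bsub>G\<^esub> y" if xy: "x \<in> carrier G" "y \<in> carrier G" "h x = h y" for x y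
  proof -
    have "x \<in> N0 #>\<^bsub>G\<^esub> y"
      using h_eqD[OF xy] xy by (intro N0.rcos_module_rev[OF is_group]) (auto simp: N_def)
    then show ?thesis using repr_independence[OF _ xy(2) N0.subgroup_axioms] by simp
  qed
  then obtain \<psi> where "value_cover w Q ?F \<psi>"
    using value_cover_of_quotient[OF hom0 onto0 determined hom onto finQ] by blast
  then have "card (verbal_subgroup Q w) \<le> B" by (rule B)
  moreover have "card (h ` A) \<le> card (verbal_subgroup Q w)"
    using A(1) finite_subset[OF verbal_subgroup_subset[OF Q(1)] finQ]
    by (intro card_mono) (auto simp: verbal_subgroup_image[OF hom onto])
  moreover have "inj_on h A"
  proof (rule inj_onI)
    fix x y assume xy: "x \<in> A" "y \<in> A" "h x = h y"
    then have "x \<otimes>\<^bsub>G\<^esub> inv\<^bsub>G\<^esub> y \<in> N1" using h_eqD[of x y] AG by (auto simp: N_def)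
    then show "x = y" using xy by (intro sep1)
  qed
  ultimately show False using A(3) by (simp add: card_image)
qed

section \<open>Reduction of the converse to countable subgroups\<close>

text \<open>Preimages of normal subgroups of finite index are of the same kind, and injectivity
  keeps nontrivial elements nontrivial.\<close>

lemma residually_finite_if_embeds:
  assumes "group_hom G H f" "inj_on f (carrier G)" "residually_finite H"
  shows "residually_finite G"
proof -
  interpret group_hom G H f by fact
  have "\<exists>N. N \<lhd> G \<and> finite (rcosets\<^bsub>G\<^esub> N) \<and> x \<notin> N" if x: "x \<in> carrier G" "x \<noteq> \<one>\<^bsub>G\<^esub>" for x
  proof -
    have "f x \<noteq> \<one>\<^bsub>H\<^esub>" using x assms(2) by (metis G.one_closed hom_one inj_onD)
    then obtain M where M: "M \<lhd> H" "finite (rcosets\<^bsub>H\<^esub> M)" "f x \<notin> M"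
      using assms(3) hom_closed[OF x(1)] unfolding residually_finite_def by blast
    interpret M: normal M H by (rule M)
    define N where "N = {y \<in> carrier G. f y \<in> M}"
    have N: "N \<lhd> G"
      unfolding G.normal_inv_iff
    proof (intro conjI ballI G.subgroupI)
      show "N \<noteq> {}" using M.one_closed by (auto simp: N_def intro!: exI[of _ "\<one>\<^bsub>G\<^esub>"])
    qed (auto simp: N_def M.inv_op_closed2)
    moreover have "finite (rcosets\<^bsub>G\<^esub> N)"
    proof (rule G.finite_rcosetsI[OF normal_imp_subgroup[OF N]])
      let ?c = "\<lambda>y. M #>\<^bsub>H\<^esub> f y"
      have "?c ` carrier G \<subseteq> rcosets\<^bsub>H\<^esub> M" using H.rcosetsI[OF M.subset] by auto
      then show "finite (?c ` carrier G)" using M(2) by (rule finite_subset)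
      fix y z assume "y \<in> carrier G" "z \<in> carrier G" "?c y = ?c z"
      then show "y \<otimes>\<^bsub>G\<^esub> inv\<^bsub>G\<^esub> z \<in> N"
        using H.rcosets_eqD[OF M.subgroup_axioms, of "f y" "f z"] by (simp add: N_def)
    qed
    ultimately show ?thesis using M(3) by (auto simp: N_def)
  qed
  then show ?thesis by (simp add: residually_finite_def G.is_group)
qed

text \<open>Inverses come from reversing a word and flipping its signs. Describing the generated
  subgroup by words makes it visibly countable.\<close>

lemma subgroup_range_word_eval:
  assumes "group G" "\<And>i. e i \<in> carrier G"
  shows "subgroup (range (word_eval G e)) G"
proof -
  interpret group G by fact
  have inv: "inv\<^bsub>G\<^esub> word_eval G e u = word_eval G e (rev (map (\<lambda>(i, b). (i, \<not> b)) u))" for u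
  proof (induction u)
    case (Cons l u)
    then show ?case
      using assms(2) word_eval_closed[of G e u, OF assms]
      by (cases l) (auto simp: word_eval_append[of G e, OF assms] inv_mult_group)
  qed simp
  show ?thesis
  proof (rule subgroupI)
    fix x y assume "x \<in> range (word_eval G e)" "y \<in> range (word_eval G e)"
    then show "x \<otimes>\<^bsub>G\<^esub> y \<in> range (word_eval G e)"
      by (auto simp: word_eval_append[of G e, OF assms, symmetric])
  qed (use word_eval_closed[of G e, OF assms] in \<open>auto simp: inv\<close>)
qed

text \<open>One assignment is chosen for each of the finitely many values; its entries at the
  variables of \<open>w\<close>, together over all values, generate \<open>K\<close>.\<close>

lemma countable_subgroup_with_all_word_values:
  assumes "group G" "finite (word_values G w)"
  obtains K where "subgroup K G" "countable K" "word_values (G\<lparr>carrier := K\<rparr>) w = word_values G w"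
proof -
  interpret group G by fact
  define V where "V = fst ` set w"
  have "\<forall>v\<in>word_values G w. \<exists>g. v = word_eval G g w \<and> (\<forall>i. g i \<in> carrier G)"
    by (auto simp: word_values_def)
  then obtain g where g: "\<And>v. v \<in> word_values G w \<Longrightarrow> v = word_eval G (g v) w"
    "\<And>v i. v \<in> word_values G w \<Longrightarrow> g v i \<in> carrier G"
    by metis
  \<comment> \<open>The identity makes \<open>E\<close> nonempty for the enumeration
    \<open>e\<close> and serves as the entry for variables outside \<open>V\<close>.\<close>
  define E where "E = insert \<one>\<^bsub>G\<^esub> ((\<lambda>(v, i). g v i) ` (word_values G w \<times> V))"
  define e where "e = from_nat_into E"
  have "countable E" using assms(2) by (auto simp: E_def V_def intro: countable_finite)
  then have e: "range e = E" unfolding e_def by (intro range_from_nat_into) (auto simp: E_def)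
  have "E \<subseteq> carrier G" using g(2) by (auto simp: E_def)
  then have eG: "e i \<in> carrier G" for i using e by blast
  define K where "K = range (word_eval G e)"
  have K: "subgroup K G" unfolding K_def by (rule subgroup_range_word_eval[OF is_group eG])
  have "E \<subseteq> K"
  proof
    fix x assume "x \<in> E"
    then obtain i where "x = e i" using e by blast
    then have "x = word_eval G e [(i, True)]" using eG by simp
    then show "x \<in> K" unfolding K_def by blast
  qed
  have "word_values G w \<subseteq> word_values (G\<lparr>carrier := K\<rparr>) w"
  proof
    fix v assume v: "v \<in> word_values G w"
    define g' where "g' i = (if i \<in> V then g v i else \<one>\<^bsub>G\<^esub>)" for i
    have g': "g' i \<in> K" for i using v \<open>E \<subseteq> K\<close> by (auto simp: g'_def E_def)
    have "v = word_eval G (g v) w" using g(1) v .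
    also have "\<dots> = word_eval G g' w" by (rule word_eval_cong) (simp add: g'_def V_def)
    also have "\<dots> = word_eval (G\<lparr>carrier := K\<rparr>) g' w"
      by (rule word_eval_subgroup[OF is_group K g', symmetric])
    finally show "v \<in> word_values (G\<lparr>carrier := K\<rparr>) w"
      using g' unfolding word_values_def by auto
  qed
  then have "word_values (G\<lparr>carrier := K\<rparr>) w = word_values G w"
    using word_values_subgroup_subset[OF is_group K] by blast
  moreover have "countable K" unfolding K_def by simp
  ultimately show thesis using K that by blast
qed

text \<open>Residual finiteness passes from the profinite group to a countable subgroup with the
  same word values, whose verbal subgroup is the same.\<close>

theorem concise_in_virtually_pro_p_groups:
  fixes w :: group_word
  assumes "infinite (UNIV :: 'a set)"
    and "concise_in w (residually_finite_groups :: 'a monoid set)"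
  shows "concise_in w (virtually_pro_p_groups :: 'b monoid set)"
  unfolding concise_in_def
proof (intro ballI impI)
  fix G :: "'b monoid"
  assume "G \<in> virtually_pro_p_groups" and fin: "finite (word_values G w)"
  then obtain p T where "virtually_pro_p_group p G T" by (auto simp: virtually_pro_p_groups_def)
  then have rf: "residually_finite G"
    using profinite_imp_residually_finite by (auto simp: virtually_pro_p_group_def)
  interpret group G using rf by (simp add: residually_finite_def)
  obtain K where K: "subgroup K G" "countable K" "word_values (G\<lparr>carrier := K\<rparr>) w = word_values G w"
    using countable_subgroup_with_all_word_values[OF is_group fin] by blast
  let ?K = "G\<lparr>carrier := K\<rparr>"
  have gK: "group ?K" using K(1) is_group by (rule subgroup.subgroup_is_group)
  \<comment> \<open>Countability of \<open>K\<close> is what allows a copy of it on any infinite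
    type \<open>'a\<close>.\<close>
  obtain t :: "nat \<Rightarrow> 'a" where t: "inj t" using assms(1) infinite_countable_subset by blast
  have inj: "inj_on (\<lambda>x. t (to_nat_on K x)) (carrier ?K)"
    using inj_on_to_nat_on[OF K(2)] t by (auto simp: inj_on_def)
  define L where "L = image_group (\<lambda>x. t (to_nat_on K x)) ?K"
  obtain f where L: "group L" and f: "f \<in> iso ?K L"
    using image_group_iso[OF gK inj] unfolding L_def by blast
  define f' where "f' = inv_into (carrier ?K) f"
  have f': "f' \<in> iso L ?K" unfolding f'_def by (rule group.iso_set_sym[OF gK f])
  have hom: "group_hom L ?K f'" and hom2: "group_hom ?K L f"
    using f f' L gK by (simp_all add: iso_def group_hom_def group_hom_axioms_def)
  have onto: "f' ` carrier L = carrier ?K" "f ` carrier ?K = carrier L" and inj': "inj_on f' (carrier L)"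
    using f f' by (auto simp: iso_def bij_betw_def)
  have "group_hom L G f'"
    using hom K(1) is_group by (auto simp: group_hom_def group_hom_axioms_def hom_def Pi_iff subgroup.mem_carrier)
  then have "residually_finite L" using inj' rf by (rule residually_finite_if_embeds)
  moreover have "finite (word_values L w)"
    using fin by (simp add: word_values_image[OF hom2 onto(2)] K(3))
  ultimately have "finite (verbal_subgroup L w)"
    using assms(2) by (auto simp: concise_in_def residually_finite_groups_def)
  then have "finite (verbal_subgroup ?K w)" by (simp add: verbal_subgroup_image[OF hom onto(1)])
  then show "finite (verbal_subgroup G w)"
    by (simp add: verbal_subgroup_eq_if_word_values_eq[OF is_group K(1,3)])
qed

text \<open>An infinite \<open>'a\<close> has room for the countable subgroups of one direction, and
  a \<open>'b\<close> as large as the reals for the fibre products of the other.\<close>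

theorem proposition6p5:
  fixes w :: group_word
  assumes "infinite (UNIV :: 'a set)"
    and "(UNIV :: real set) \<lesssim> (UNIV :: 'b set)"
  shows "concise_in w (residually_finite_groups :: 'a monoid set) \<longleftrightarrow>
         concise_in w (virtually_pro_p_groups :: 'b monoid set)"
  using concise_in_residually_finite_groups[OF assms(2)] concise_in_virtually_pro_p_groups[OF assms(1)]
  by blast

end
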